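(* Let $p \ge 1$ and let $\mu$ be a probability measure on $\mathbb{C}^p$ such that for every row vector $c \in \mathbb{C}^p$ and every $d \in \mathbb{C}$ with $(c,d) \neq (0,0)$, $\mu(\{z \in \mathbb{C}^p : cz + d = 0\}) = 0$. Then $\mu$ is a Cauchy distribution on $\mathbb{C}^p$ if and only if for every $g \in \mathrm{GL}(p+1,\mathbb{C})$ there exists $a \in \mathrm{A}(p+1,\mathbb{C})$ such that $g \cdot \mu = a \cdot \mu$.
   Context: $\mathrm{GL}(p+1,\mathbb{C})$ is the group of invertible complex $(p+1)\times(p+1)$ matrices. Write $g \in \mathrm{GL}(p+1,\mathbb{C})$ in block form $g = \begin{pmatrix} a & b \\ c & d \end{pmatrix}$, where $a$ is a complex $p \times p$ matrix, $b$ is a $p$-dimensional column vector, $c$ is a $p$-dimensional row vector and $d \in \mathbb{C}$. The associated transformation of $\mathbb{C}^p$ (column vectors) is $$M_g(z) = \frac{az+b}{cz+d}, \quad z \in \mathbb{C}^p,$$ defined where $cz + d \neq 0$. $\mathrm{A}(p+1,\mathbb{C})$ denotes the subgroup of those $g \in \mathrm{GL}(p+1,\mathbb{C})$ with $c = 0$, for which $M_g$ is an affine transformation. For a probability measure $\mu$ on $\mathbb{C}^p$ and $g \in \mathrm{GL}(p+1,\mathbb{C})$, $g \cdot \mu$ is the probability measure on $\mathbb{C}^p$ defined by $g\cdot\mu(X) = \mu\{M_g^{-1}(X)\}$ for measurable $X \subset \mathbb{C}^p$, where $M_g^{-1}(X) = \{z \in \mathbb{C}^p : M_g(z) \in X\}$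 (the set where $M_g$ is undefined being $\mu$-null). The standard Cauchy distribution $\gamma$ on $\mathbb{C}^p$ is the probability measure $$\gamma(dz) = \pi^{-p}\,\Gamma(p+1)\,(1+\|z\|^2)^{-(p+1)}\,dz,$$ where $\|z\| = (|z_1|^2+\cdots+|z_p|^2)^{1/2}$ and $dz$ is Lebesgue measure on $\mathbb{C}^p \cong \mathbb{R}^{2p}$. A Cauchy distribution on $\mathbb{C}^p$ is any measure of the form $\alpha \cdot \gamma$ with $\alpha \in \mathrm{A}(p+1,\mathbb{C})$. *)

theory Defs
  imports "HOL-Analysis.Analysis" "HOL-Probability.Probability"
begin

(* With 'p of class finite and p = CARD('p), C^p is the type complex ^ 'p.  Matrices of size p + 1 are
   indexed by 'p option: the indices Some i are the first p coordinates, None is the last one. *)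

definition block_a :: "complex ^ 'p::finite option ^ 'p option \<Rightarrow> complex ^ 'p ^ 'p" where
  "block_a g = (\<chi> i j. g $ Some i $ Some j)"

definition block_b :: "complex ^ 'p::finite option ^ 'p option \<Rightarrow> complex ^ 'p" where
  "block_b g = (\<chi> i. g $ Some i $ None)"

definition block_c :: "complex ^ 'p::finite option ^ 'p option \<Rightarrow> complex ^ 'p" where
  "block_c g = (\<chi> j. g $ None $ Some j)"

definition block_d :: "complex ^ 'p::finite option ^ 'p option \<Rightarrow> complex" where
  "block_d g = g $ None $ None"

definition GL :: "(complex ^ 'p::finite option ^ 'p option) set" where
  "GL = {g. invertible g}"

definition Aff :: "(complex ^ 'p::finite option ^ 'p option) set" where
  "Aff = {g \<in> GL. block_c g = 0}"

(* scalar_product is bilinear, unlike the real inner product of complex ^ 'p. *)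
definition denom :: "complex ^ 'p::finite option ^ 'p option \<Rightarrow> complex ^ 'p \<Rightarrow> complex" where
  "denom g z = scalar_product (block_c g) z + block_d g"

definition proj_map :: "complex ^ 'p::finite option ^ 'p option \<Rightarrow> complex ^ 'p \<Rightarrow> complex ^ 'p" where
  "proj_map g z = (1 / denom g z) *s (block_a g *v z + block_b g)"

(* proj_map is total because 1 / 0 = 0.  The measure is therefore restricted to the domain
   {z. denom g z \<noteq> 0} before it is pushed forward, so the points where the transformation is
   undefined contribute no mass. *)
definition act :: "complex ^ 'p::finite option ^ 'p option \<Rightarrow> (complex ^ 'p) measure \<Rightarrow> (complex ^ 'p) measure"
  where "act g \<mu> = distr (restrict_space \<mu> {z. denom g z \<noteq> 0}) borel (proj_map g)"

(* lborel on complex ^ 'p is Lebesgue measure on R^(2p), and norm is the Hermitian norm. *)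
definition std_cauchy :: "(complex ^ 'p::finite) measure" where
  "std_cauchy = density lborel (\<lambda>z. ennreal
     (Gamma (real CARD('p) + 1) / (pi ^ CARD('p) * (1 + (norm z)\<^sup>2) ^ (CARD('p) + 1))))"

definition is_cauchy :: "(complex ^ 'p::finite) measure \<Rightarrow> bool" where
  "is_cauchy \<mu> \<longleftrightarrow> (\<exists>\<alpha> \<in> Aff. \<mu> = act \<alpha> std_cauchy)"

end

theory Submission
  imports Defs
begin

text \<open>
  In homogeneous coordinates a point \<open>z\<close> is the column \<open>(z, 1)\<close>, hyperplanes are the zero sets of
  nonzero row vectors, and GL acts linearly on both.  Two facts about the standard Cauchy
  distribution carry the easy direction.  It is invariant under unitary matrices, because it is the
  image of the uniform distribution on the unit ball under projection from the origin
  (\<open>act_unitary_std_cauchy\<close>); and every invertible matrix is an affine matrix times a unitary one,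
  because a row vector extends to a unitary matrix.  Hence every projective image of the standard
  Cauchy distribution is an affine one (\<open>act_GL_std_cauchy\<close>), and the same follows for all its
  affine images.

  For the converse let \<open>H\<close> be the stabiliser of \<open>\<mu>\<close> in GL.  The hypothesis says that GL is the
  product of the affine group and \<open>H\<close>.  As the affine group is the stabiliser of the hyperplane at
  infinity, this means that \<open>H\<close> is transitive on hyperplanes (\<open>stabilizer_transitive\<close>).  Because
  \<open>\<mu>\<close> charges no hyperplane, \<open>H\<close> is compact modulo scalars: if not, then normalised elements of \<open>H\<close>
  would converge to a singular matrix, and \<open>\<mu>\<close> would live on its image (\<open>stabilizer_det_bound\<close>).
  The elements of \<open>H\<close> with determinant of modulus one therefore preserve a norm on columns, the
  supremum over an orbit.  Integrating \<open>r x\<close> times the conjugate of \<open>s x\<close>, divided by the square of this norm of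
  \<open>x\<close>, against \<open>\<mu>\<close> gives a positive definite Hermitian form on rows which these elements preserve, so that one
  change of coordinates turns all of them into unitary matrices (\<open>unitarizable\<close>).

  In the new coordinates \<open>\<mu>\<close> and the standard Cauchy distribution are both invariant under groups
  of unitary matrices which are transitive on hyperplanes.  So for both measures the mass of a ball in
  the chordal metric depends on the radius only.  A probability measure with this property is unique
  (\<open>uniformly_distributed_unique\<close>), and \<open>\<mu>\<close> is a projective image of the standard Cauchy
  distribution, hence an affine one.
\<close>

section \<open>Rows, columns and complex matrices\<close>

lemma sum_UNIV_option:
  "(\<Sum>i\<in>(UNIV :: 'p::finite option set). f i) = f None + (\<Sum>j\<in>UNIV. f (Some j))"
  by (simp add: UNIV_option_conv sum.reindex)

lemma scalar_product_adjoint: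
  fixes g :: "'a::comm_semiring_1 ^ 'n::finite ^ 'm::finite"
  shows "scalar_product (s v* g) x = scalar_product s (g *v x)"
proof -
  have "(\<Sum>j\<in>UNIV. (\<Sum>i\<in>UNIV. s $ i * g $ i $ j) * x $ j) = (\<Sum>i\<in>UNIV. s $ i * (\<Sum>j\<in>UNIV. g $ i $ j * x $ j))"
    unfolding sum_distrib_left sum_distrib_right mult.assoc by (rule sum.swap)
  then show ?thesis
    by (simp add: scalar_product_def vector_matrix_mult_def matrix_vector_mult_def)
qed

lemma scalar_product_smult_left: "scalar_product (k *s s) x = k * scalar_product s (x :: 'a::comm_semiring_1 ^ 'n::finite)"
  by (simp add: scalar_product_def sum_distrib_left mult.assoc)

lemma scalar_product_smult_right: "scalar_product s (k *s x) = k * scalar_product s (x :: 'a::comm_semiring_1 ^ 'n::finite)"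
  by (simp add: scalar_product_def sum_distrib_left mult_ac)

lemma matrix_row_mult: "(g ** h) $ i = (g $ i) v* (h :: 'a::semiring_1 ^ 'n::finite ^ 'm::finite)"
  by (simp add: matrix_matrix_mult_def vector_matrix_mult_def vec_eq_iff)

lemma axis_vector_matrix_mult: "axis i 1 v* (g :: 'a::comm_semiring_1 ^ 'n::finite ^ 'm::finite) = g $ i"
  by (simp add: vector_matrix_mult_def axis_def vec_eq_iff if_distribR if_distrib cong: if_cong)

lemma norm_smult: "norm (k *s (x :: complex ^ 'n::finite)) = norm k * norm x"
proof -
  have "norm (k *s x) = L2_set (\<lambda>i. norm k * norm (x $ i)) UNIV"
    by (simp add: norm_vec_def norm_mult)
  also have "\<dots> = norm k * norm x" by (simp add: L2_set_right_distrib norm_vec_def)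
  finally show ?thesis .
qed

lemma norm_scalar_product_le: "norm (scalar_product s x) \<le> norm s * norm (x :: complex ^ 'n::finite)"
proof -
  have "norm (scalar_product s x) \<le> (\<Sum>i\<in>UNIV. \<bar>norm (s $ i)\<bar> * \<bar>norm (x $ i)\<bar>)"
    unfolding scalar_product_def by (rule order_trans[OF norm_sum]) (simp add: norm_mult)
  also have "\<dots> \<le> norm s * norm x"
    unfolding norm_vec_def by (rule L2_set_mult_ineq)
  finally show ?thesis .
qed

lemma matrix_vector_nth: "(g *v x) $ i = scalar_product (g $ i) x"
  by (simp add: matrix_vector_mult_def scalar_product_def)

lemma norm_matrix_vector_le: "norm (g *v x) \<le> norm g * norm (x :: complex ^ 'n::finite)"
proof -
  have "norm (g *v x) \<le> L2_set (\<lambda>i. norm (g $ i) * norm x) UNIV"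
    unfolding norm_vec_def[of "g *v x"] matrix_vector_nth
    by (intro L2_set_mono norm_scalar_product_le) simp
  also have "\<dots> = norm g * norm x"
    unfolding norm_vec_def[of g] by (rule L2_set_left_distrib[symmetric]) simp
  finally show ?thesis .
qed

lemma det_scaleR: "det (c *\<^sub>R g :: complex ^ 'n::finite ^ 'n) = of_real c ^ CARD('n) * det g"
proof -
  have "c *\<^sub>R g = (\<chi> i. of_real c *s (g $ i))"
    by (simp add: vec_eq_iff scaleR_conv_of_real[where 'a=complex])
  then show ?thesis by (simp add: det_rows_mul)
qed

lemma tendsto_det:
  fixes T :: "'b \<Rightarrow> complex ^ 'n::finite ^ 'n"
  assumes "(T \<longlongrightarrow> g) F" shows "((\<lambda>k. det (T k)) \<longlongrightarrow> det g) F"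
  unfolding det_def by (intro tendsto_intros assms)

lemma det_zero_kernel:
  fixes g :: "complex ^ 'n::finite ^ 'n"
  assumes "det g = 0" obtains x where "x \<noteq> 0" "g *v x = 0"
proof -
  have "\<not> invertible g" using assms by (simp add: invertible_det_nz)
  then have "\<not> (\<exists>B. B ** g = mat 1)" by (simp add: invertible_left_inverse)
  then show ?thesis using that unfolding matrix_left_invertible_ker by blast
qed

lemma det_zero_left_kernel:
  fixes g :: "complex ^ 'n::finite ^ 'n"
  assumes "det g = 0" obtains s where "s \<noteq> 0" "s v* g = 0"
  using det_zero_kernel[of "transpose g"] assms by auto

text \<open>
  A trivial kernel on rows suffices: this is the form in which invertibility comes out of an orthonormal
  family of rows.
\<close>

lemma GL_left_kernel:
  assumes "\<And>s. s v* g = 0 \<Longrightarrow> s = 0" shows "g \<in> GL"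
  using det_zero_left_kernel[of g] assms unfolding GL_def invertible_det_nz by blast

definition cvec :: "complex ^ 'n::finite \<Rightarrow> complex ^ 'n" where
  "cvec x = (\<chi> i. cnj (x $ i))"

lemma scalar_product_cvec: "scalar_product x (cvec x) = of_real ((norm x)\<^sup>2)"
proof -
  have "of_real ((norm x)\<^sup>2) = (\<Sum>i\<in>UNIV. complex_of_real ((norm (x $ i))\<^sup>2))"
    unfolding of_real_sum[symmetric] by (simp add: norm_vec_def L2_set_def sum_nonneg)
  then show ?thesis
    by (simp only: scalar_product_def cvec_def vec_lambda_beta complex_norm_square)
qed

definition adjoint_matrix :: "complex ^ 'n::finite ^ 'n \<Rightarrow> complex ^ 'n ^ 'n" where
  "adjoint_matrix g = (\<chi> i j. cnj (g $ j $ i))"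

definition unitary :: "complex ^ 'n::finite ^ 'n \<Rightarrow> bool" where
  "unitary u \<longleftrightarrow> u ** adjoint_matrix u = mat 1"

lemma unitary_GL: "unitary u \<Longrightarrow> u \<in> GL"
  unfolding unitary_def GL_def by (auto simp: invertible_right_inverse)

lemma scalar_product_commute: "scalar_product x y = scalar_product y (x :: complex ^ 'n::finite)"
  by (simp add: scalar_product_def mult.commute)

lemma cvec_mult_left: "cvec (s v* u) = adjoint_matrix u *v cvec s"
  by (simp add: cvec_def vector_matrix_mult_def matrix_vector_mult_def adjoint_matrix_def vec_eq_iff mult.commute)

lemma cvec_mult_right: "cvec (u *v x) = cvec x v* adjoint_matrix u"
  by (simp add: cvec_def vector_matrix_mult_def matrix_vector_mult_def adjoint_matrix_def vec_eq_iff mult.commute)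

lemma unitary_norm_row:
  assumes "unitary u" shows "norm (s v* u) = norm s"
proof -
  have "of_real ((norm (s v* u))\<^sup>2) = scalar_product s ((u ** adjoint_matrix u) *v cvec s)"
    by (simp only: scalar_product_cvec[symmetric] cvec_mult_left scalar_product_adjoint matrix_vector_mul_assoc)
  also have "\<dots> = of_real ((norm s)\<^sup>2)"
    using assms by (simp add: unitary_def scalar_product_cvec)
  finally have "(norm (s v* u))\<^sup>2 = (norm s)\<^sup>2" by (simp only: of_real_eq_iff)
  then show ?thesis by simp
qed

lemma unitary_norm:
  assumes "unitary u" shows "norm (u *v x) = norm x"
proof -
  have "adjoint_matrix u ** u = mat 1"
    using assms by (simp add: unitary_def matrix_left_right_inverse)
  then have "of_real ((norm x)\<^sup>2) = scalar_product (cvec x) ((adjoint_matrix u ** u) *v x)"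
    by (simp add: scalar_product_cvec scalar_product_commute[of "cvec x"])
  also have "\<dots> = of_real ((norm (u *v x))\<^sup>2)"
    by (simp only: scalar_product_cvec[symmetric] cvec_mult_right scalar_product_commute[of "u *v x"]
        scalar_product_adjoint matrix_vector_mul_assoc)
  finally have "(norm (u *v x))\<^sup>2 = (norm x)\<^sup>2" by (simp only: of_real_eq_iff)
  then show ?thesis by simp
qed

section \<open>Orthonormal bases of Hermitian forms\<close>

text \<open>
  The Gram-Schmidt process, started at a prescribed vector.  A vector orthogonal to fewer than \<open>n\<close>
  given ones is a kernel vector of a square matrix with a zero row.
\<close>

lemma hermitian_form_orthonormal_basis:
  fixes S :: "complex ^ 'n::finite \<Rightarrow> complex ^ 'n \<Rightarrow> complex"
  assumes add: "\<And>r r' s. S (r + r') s = S r s + S r' s" and smult: "\<And>k r s. S (k *s r) s = k * S r s"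
    and herm: "\<And>r s. cnj (S r s) = S s r" and pos: "\<And>r. r \<noteq> 0 \<Longrightarrow> Re (S r r) > 0"
    and x0: "x0 \<noteq> 0"
  shows "\<exists>v c. c \<noteq> 0 \<and> v (i0 :: 'n) = c *s x0 \<and> (\<forall>i j. S (v i) (v j) = (if i = j then 1 else 0))"
proof -
  have smult2: "S r (k *s s) = cnj k * S r s" for k r s by (metis herm smult complex_cnj_mult)
  have zero: "S 0 s = 0" for s using smult[of 0 0 s] by simp
  have sum: "S (\<Sum>j\<in>A. f j) s = (\<Sum>j\<in>A. S (f j) s)" if "finite A" for A :: "'n set" and f s
    using that by (induction A rule: finite_induct) (simp_all add: zero add)
  have normalise: "\<exists>c. c \<noteq> 0 \<and> S (c *s x) (c *s x) = 1" if "x \<noteq> 0" for x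
  proof -
    define a where "a = Re (S x x)"
    have a: "a > 0" using pos[OF that] by (simp add: a_def)
    have Sxx: "S x x = of_real a" using herm[of x x] by (simp add: a_def complex_eq_iff)
    define c where "c = complex_of_real (1 / sqrt a)"
    have "S (c *s x) (c *s x) = of_real (1 / sqrt a * (1 / sqrt a) * a)"
      by (simp only: c_def smult smult2 Sxx of_real_mult complex_cnj_complex_of_real mult.assoc)
    also have "1 / sqrt a * (1 / sqrt a) * a = 1" using a by (simp add: real_sqrt_mult_self field_simps)
    finally have "S (c *s x) (c *s x) = 1" by simp
    moreover have "c \<noteq> 0" using a by (simp add: c_def)
    ultimately show ?thesis by blast
  qed
  obtain c0 where c0: "c0 \<noteq> 0" "S (c0 *s x0) (c0 *s x0) = 1" using normalise[OF x0] by blast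
  have "\<exists>v. v i0 = c0 *s x0 \<and> (\<forall>i\<in>insert i0 F. \<forall>j\<in>insert i0 F. S (v i) (v j) = (if i = j then 1 else 0))"
    if "finite F" "i0 \<notin> F" for F :: "'n set"
    using that
  proof (induction F rule: finite_induct)
    case empty
    then show ?case using c0 by (intro exI[of _ "\<lambda>_. c0 *s x0"]) simp
  next
    case (insert k F)
    let ?F = "insert i0 F"
    have k: "k \<notin> ?F" using insert by auto
    obtain v where v0: "v i0 = c0 *s x0"
      and v: "\<And>i j. i \<in> ?F \<Longrightarrow> j \<in> ?F \<Longrightarrow> S (v i) (v j) = (if i = j then 1 else 0)"
      using insert by blast
    define A :: "complex ^ 'n ^ 'n" where "A = (\<chi> i j. if i \<in> ?F then S (axis j 1) (v i) else 0)"
    have "row k A = 0" using k by (simp add: A_def row_def vec_eq_iff)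
    then have "det A = 0" by (rule det_zero_row)
    then obtain x where x: "x \<noteq> 0" "A *v x = 0" by (rule det_zero_kernel)
    have orth: "S x (v i) = 0" if "i \<in> ?F" for i
    proof -
      have "S x (v i) = S (\<Sum>j\<in>UNIV. x $ j *s axis j 1) (v i)" by (simp only: basis_expansion)
      also have "\<dots> = (A *v x) $ i"
        using that by (simp add: sum smult A_def matrix_vector_mult_def mult.commute)
      finally show ?thesis by (simp add: x(2))
    qed
    obtain c where c: "S (c *s x) (c *s x) = 1" using normalise[OF x(1)] by blast
    define w where "w = c *s x"
    have w_orth: "S w (v i) = 0" "S (v i) w = 0" if "i \<in> ?F" for i
    proof -
      show "S w (v i) = 0" using orth[OF that] by (simp add: w_def smult)
      then show "S (v i) w = 0" by (metis herm complex_cnj_zero)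
    qed
    have "S ((v(k := w)) i) ((v(k := w)) j) = (if i = j then 1 else 0)"
      if "i \<in> insert k ?F" "j \<in> insert k ?F" for i j
    proof (cases "i = k"; cases "j = k")
      assume "i \<noteq> k" "j \<noteq> k"
      then show ?thesis using that v by simp
    qed (use that w_orth c w_def in auto)
    moreover have "(v(k := w)) i0 = c0 *s x0" using k v0 by auto
    ultimately show ?case by (intro exI[of _ "v(k := w)"] conjI ballI) (auto simp only: insert_iff)
  qed
  note orthonormal = this[of "UNIV - {i0}"]
  have "insert i0 (UNIV - {i0}) = (UNIV :: 'n set)" by auto
  with orthonormal obtain v where "v i0 = c0 *s x0" "\<forall>i j. S (v i) (v j) = (if i = j then 1 else 0)" by auto
  with c0(1) show ?thesis by blast
qed

text \<open>
  This yields both the factorisation of an invertible matrix into an affine and a unitary one, and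
  the transitivity of the unitary group on hyperplanes.
\<close>

lemma exists_unitary_row:
  assumes "s \<noteq> 0" obtains u :: "complex ^ 'n::finite ^ 'n" and k where "unitary u" "k \<noteq> 0" "u $ i = k *s s"
proof -
  define S where "S r s = scalar_product r (cvec s)" for r s :: "complex ^ 'n"
  have "Re (S r r) > 0" if "r \<noteq> 0" for r using that by (simp add: S_def scalar_product_cvec)
  moreover have "S (r + r') t = S r t + S r' t" "S (k *s r) t = k * S r t" "cnj (S r t) = S t r" for r r' t k
    by (simp_all add: S_def scalar_product_def cvec_def algebra_simps sum.distrib sum_distrib_left)
  ultimately obtain v :: "'n \<Rightarrow> complex ^ 'n" and c where c: "c \<noteq> 0" "v i = c *s s"
    and v: "\<And>i j. S (v i) (v j) = (if i = j then 1 else 0)"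
    using hermitian_form_orthonormal_basis[of S s i] assms by blast
  define u :: "complex ^ 'n ^ 'n" where "u = (\<chi> i. v i)"
  have "unitary u"
    using v by (simp add: unitary_def vec_eq_iff matrix_matrix_mult_def adjoint_matrix_def mat_def u_def S_def scalar_product_def cvec_def)
  moreover have "u $ i = c *s s" by (simp add: u_def c)
  ultimately show ?thesis using c(1) that by blast
qed

section \<open>Projective maps and their action on measures\<close>

text \<open>
  The additional index \<open>None\<close> carries the homogenising coordinate 1, so that the last row of a matrix
  computes the denominator of its projective map.
\<close>

definition homog :: "complex ^ 'p::finite \<Rightarrow> complex ^ 'p option" where
  "homog z = (\<chi> i. case i of None \<Rightarrow> 1 | Some j \<Rightarrow> z $ j)"

lemma homog_nth [simp]: "homog z $ None = 1" "homog z $ Some j = z $ j"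
  by (simp_all add: homog_def)

lemma homog_nonzero [simp]: "homog z \<noteq> 0"
  by (metis homog_nth(1) zero_index zero_neq_one)

lemma continuous_on_homog [continuous_intros]:
  assumes "continuous_on A f" shows "continuous_on A (\<lambda>x. homog (f x))"
  unfolding homog_def
proof (intro continuous_intros)
  fix i :: "'b option" show "continuous_on A (\<lambda>x. case i of None \<Rightarrow> 1 | Some j \<Rightarrow> f x $ j)"
    using assms by (cases i) (auto intro!: continuous_intros)
qed

lemma measurable_homog [measurable]: "homog \<in> borel_measurable borel"
  by (intro borel_measurable_continuous_onI continuous_intros)

lemma norm_homog: "(norm (homog z))\<^sup>2 = 1 + (norm z)\<^sup>2"
  by (simp add: norm_vec_def L2_set_def sum_UNIV_option real_sqrt_pow2 sum_nonneg add_nonneg_nonneg)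

lemma smult_homog_eq_iff: "k *s homog z = l *s homog w \<longleftrightarrow> k = l \<and> (k = 0 \<or> z = w)"
proof
  assume eq: "k *s homog z = l *s homog w"
  from arg_cong[OF this, of "\<lambda>x. x $ None"] have "k = l" by simp
  moreover have "k * z $ j = l * w $ j" for j using arg_cong[OF eq, of "\<lambda>x. x $ Some j"] by simp
  ultimately show "k = l \<and> (k = 0 \<or> z = w)" by (auto simp: vec_eq_iff)
qed auto

lemma denom_homog: "denom g z = (g *v homog z) $ None"
  by (simp add: denom_def matrix_vector_mult_def scalar_product_def sum_UNIV_option block_c_def block_d_def)

lemma denom_row: "denom g z = scalar_product (g $ None) (homog z)"
  by (simp add: denom_def scalar_product_def sum_UNIV_option block_c_def block_d_def)

lemma matrix_mult_homog:
  assumes "denom g z \<noteq> 0"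
  shows "g *v homog z = denom g z *s homog (proj_map g z)"
proof (subst vec_eq_iff, intro allI)
  fix i :: "'a option"
  show "(g *v homog z) $ i = (denom g z *s homog (proj_map g z)) $ i"
    using assms
    by (cases i) (auto simp: denom_homog[symmetric] proj_map_def,
        simp add: matrix_vector_mult_def block_a_def block_b_def sum_UNIV_option field_simps)
qed

lemma continuous_on_matrix_vector [continuous_intros]:
  fixes g :: "'b::topological_space \<Rightarrow> complex ^ 'n::finite ^ 'm::finite"
  assumes "continuous_on A g" "continuous_on A f"
  shows "continuous_on A (\<lambda>x. g x *v f x)"
  unfolding matrix_vector_mult_def using assms by (intro continuous_intros) auto

lemma continuous_on_scalar_product [continuous_intros]:
  fixes f g :: "'b::topological_space \<Rightarrow> complex ^ 'n::finite"
  assumes "continuous_on A g" "continuous_on A f"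
  shows "continuous_on A (\<lambda>x. scalar_product (g x) (f x))"
  unfolding scalar_product_def using assms by (intro continuous_intros) auto

lemma continuous_on_smult [continuous_intros]:
  fixes f :: "'b::topological_space \<Rightarrow> complex ^ 'n::finite"
  assumes "continuous_on A k" "continuous_on A f"
  shows "continuous_on A (\<lambda>x. k x *s f x)"
  unfolding vector_scalar_mult_def using assms by (intro continuous_intros) auto

lemma continuous_on_denom: "continuous_on A (denom g)"
  unfolding denom_row[abs_def] by (intro continuous_intros)

lemma measurable_denom [measurable]: "denom g \<in> borel_measurable borel"
  by (intro borel_measurable_continuous_onI continuous_on_denom)

lemma measurable_smult [measurable (raw)]:
  fixes f :: "'b \<Rightarrow> complex ^ 'n::finite"
  assumes "k \<in> borel_measurable M" "f \<in> borel_measurable M"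
  shows "(\<lambda>x. k x *s f x) \<in> borel_measurable M"
  using assms by (rule borel_measurable_continuous_Pair) (intro continuous_intros)

lemma measurable_matrix_vector [measurable (raw)]:
  fixes g :: "complex ^ 'n::finite ^ 'm::finite"
  assumes "f \<in> borel_measurable M" shows "(\<lambda>x. g *v f x) \<in> borel_measurable M"
proof -
  have "(\<lambda>x. g *v x) \<in> borel_measurable borel"
    by (intro borel_measurable_continuous_onI continuous_intros)
  from measurable_compose[OF assms this] show ?thesis .
qed

lemma measurable_scalar_product [measurable (raw)]:
  fixes s :: "complex ^ 'n::finite"
  assumes "f \<in> borel_measurable M" shows "(\<lambda>x. scalar_product s (f x)) \<in> borel_measurable M"
proof -
  have "(\<lambda>x. scalar_product s x) \<in> borel_measurable borel"
    by (intro borel_measurable_continuous_onI continuous_intros)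
  from measurable_compose[OF assms this] show ?thesis .
qed

lemma measurable_proj_map [measurable]: "proj_map g \<in> borel_measurable borel"
  unfolding proj_map_def[abs_def] by measurable

lemma sets_act [simp, measurable_cong]: "sets (act g \<mu>) = sets borel"
  by (simp add: act_def)

lemma space_act [simp]: "space (act g \<mu>) = UNIV"
  by (simp add: act_def)

lemma emeasure_act:
  assumes \<mu>: "sets \<mu> = sets borel" and [measurable]: "X \<in> sets borel"
  shows "emeasure (act g \<mu>) X = emeasure \<mu> {z. denom g z \<noteq> 0 \<and> proj_map g z \<in> X}"
proof -
  note [measurable_cong] = \<mu>
  have sp: "space \<mu> = UNIV" using sets_eq_imp_space_eq[OF \<mu>] by simp
  have A: "{z. denom g z \<noteq> 0} \<in> sets \<mu>" by measurable
  have "proj_map g \<in> measurable \<mu> borel" by measurable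
  then have "emeasure (act g \<mu>) X = emeasure (restrict_space \<mu> {z. denom g z \<noteq> 0}) 
      (proj_map g -` X \<inter> space (restrict_space \<mu> {z. denom g z \<noteq> 0}))"
    unfolding act_def by (intro emeasure_distr measurable_restrict_space1) auto
  also have "\<dots> = emeasure \<mu> {z. denom g z \<noteq> 0 \<and> proj_map g z \<in> X}"
    using A by (subst emeasure_restrict_space) (auto simp: space_restrict_space sp intro!: arg_cong[where f="emeasure \<mu>"])
  finally show ?thesis .
qed

text \<open>
  When the exceptional hyperplane is null, the restriction in the definition of the action is invisible.
\<close>

lemma act_eq_distr:
  assumes \<mu>: "sets \<mu> = sets borel" and null: "emeasure \<mu> {z. denom g z = 0} = 0"
  shows "act g \<mu> = distr \<mu> borel (proj_map g)"
proof (rule measure_eqI)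
  fix X assume "X \<in> sets (act g \<mu>)"
  then have [measurable]: "X \<in> sets borel" by simp
  note [measurable_cong] = \<mu>
  have sp: "space \<mu> = UNIV" using sets_eq_imp_space_eq[OF \<mu>] by simp
  have "{z. denom g z = 0} \<in> null_sets \<mu>" using null by (intro null_setsI) measurable
  then have AE: "AE z in \<mu>. denom g z \<noteq> 0" by (rule AE_I') auto
  have "emeasure (act g \<mu>) X = emeasure \<mu> {z. denom g z \<noteq> 0 \<and> proj_map g z \<in> X}"
    by (rule emeasure_act[OF \<mu>]) simp
  also have "\<dots> = emeasure \<mu> {z. proj_map g z \<in> X}"
    using AE by (intro emeasure_eq_AE) (auto, measurable)
  also have "\<dots> = emeasure (distr \<mu> borel (proj_map g)) X"
    by (subst emeasure_distr) (auto simp: sp intro!: arg_cong[where f="emeasure \<mu>"])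
  finally show "emeasure (act g \<mu>) X = emeasure (distr \<mu> borel (proj_map g)) X" .
qed simp

text \<open>
  Points at which \<open>h\<close> is undefined are lost on the left but need not be lost on the right, where
  \<open>g ** h\<close> may be defined; hence the null set condition.
\<close>

lemma act_mult:
  fixes \<mu> :: "(complex ^ 'p::finite) measure"
  assumes \<mu>: "sets \<mu> = sets borel" and null: "emeasure \<mu> {z. denom h z = 0} = 0"
  shows "act g (act h \<mu>) = act (g ** h) \<mu>"
proof (rule measure_eqI)
  fix X assume "X \<in> sets (act g (act h \<mu>))"
  then have [measurable]: "X \<in> sets borel" by simp
  note [measurable_cong] = \<mu>
  have "{z. denom h z = 0} \<in> null_sets \<mu>" using null by (intro null_setsI) measurable
  then have AE: "AE z in \<mu>. denom h z \<noteq> 0" by (rule AE_I') auto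
  have "emeasure (act g (act h \<mu>)) X = emeasure (act h \<mu>) {z. denom g z \<noteq> 0 \<and> proj_map g z \<in> X}"
    by (rule emeasure_act) auto
  also have "\<dots> = emeasure \<mu> {z. denom h z \<noteq> 0 \<and> proj_map h z \<in> {z. denom g z \<noteq> 0 \<and> proj_map g z \<in> X}}"
    by (rule emeasure_act[OF \<mu>]) measurable
  also have "\<dots> = emeasure \<mu> {z. denom (g ** h) z \<noteq> 0 \<and> proj_map (g ** h) z \<in> X}"
  proof (rule emeasure_eq_AE)
    have *: "denom g (proj_map h z) \<noteq> 0 \<and> proj_map g (proj_map h z) \<in> X \<longleftrightarrow>
      denom (g ** h) z \<noteq> 0 \<and> proj_map (g ** h) z \<in> X" if h: "denom h z \<noteq> 0" for z
    proof -
      have eq: "(g ** h) *v homog z = denom h z *s (g *v homog (proj_map h z))"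
        by (simp add: matrix_vector_mul_assoc[symmetric] matrix_mult_homog[OF h] vec.scale)
      then have d: "denom (g ** h) z = denom h z * denom g (proj_map h z)"
        by (simp add: denom_homog[of "g ** h"] denom_homog[of g])
      have "proj_map (g ** h) z = proj_map g (proj_map h z)" if g: "denom g (proj_map h z) \<noteq> 0"
      proof -
        have gh: "denom (g ** h) z \<noteq> 0" using d g h by simp
        from eq show ?thesis
          using gh by (simp add: matrix_mult_homog[OF g] matrix_mult_homog[OF gh] vector_smult_assoc smult_homog_eq_iff)
      qed
      then show ?thesis using d h by auto
    qed
    show "AE z in \<mu>. (z \<in> {z. denom h z \<noteq> 0 \<and> proj_map h z \<in> {z. denom g z \<noteq> 0 \<and> proj_map g z \<in> X}}) =
      (z \<in> {z. denom (g ** h) z \<noteq> 0 \<and> proj_map (g ** h) z \<in> X})"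
      using AE by eventually_elim (use * in auto)
  qed measurable
  also have "\<dots> = emeasure (act (g ** h) \<mu>) X"
    by (rule emeasure_act[OF \<mu>, symmetric]) simp
  finally show "emeasure (act g (act h \<mu>)) X = emeasure (act (g ** h) \<mu>) X" .
qed simp

lemma act_one:
  fixes \<mu> :: "(complex ^ 'p::finite) measure"
  assumes \<mu>: "sets \<mu> = sets borel" shows "act (mat 1) \<mu> = \<mu>"
proof -
  have d: "denom (mat 1) z = 1" for z :: "complex ^ 'p" by (simp add: denom_homog)
  have "proj_map (mat 1) z = z" for z :: "complex ^ 'p"
    using matrix_mult_homog[of "mat 1" z] smult_homog_eq_iff[of 1 z 1 "proj_map (mat 1) z"] by (simp add: d)
  then have "proj_map (mat 1) = (\<lambda>z :: complex ^ 'p. z)" by (simp add: fun_eq_iff)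
  then show ?thesis
    using \<mu> by (subst act_eq_distr) (simp_all add: d distr_id2)
qed

lemma GL_inverse:
  assumes "g \<in> GL" obtains h where "h \<in> GL" "g ** h = mat 1" "h ** g = mat 1"
  using assms unfolding GL_def invertible_def by blast

lemma GL_mult: "g \<in> GL \<Longrightarrow> h \<in> GL \<Longrightarrow> g ** h \<in> GL"
  by (simp add: GL_def invertible_mult)

lemma GL_row_mult_nonzero:
  assumes "g \<in> GL" "s \<noteq> 0" shows "s v* g \<noteq> 0"
proof
  assume 0: "s v* g = 0"
  obtain h where "g ** h = mat 1" using GL_inverse[OF assms(1)] by blast
  then have "(s v* g) v* h = s" by (simp add: vector_matrix_mul_assoc)
  then show False using 0 assms(2) by simp
qed

lemma GL_row_nonzero:
  assumes "g \<in> GL" shows "g $ i \<noteq> 0"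
  using GL_row_mult_nonzero[OF assms, of "axis i 1"] by (simp add: axis_vector_matrix_mult)

lemma Aff_iff: "g \<in> Aff \<longleftrightarrow> g \<in> GL \<and> (\<exists>k. g $ None = k *s axis None 1)"
proof -
  have "block_c g = 0 \<longleftrightarrow> (\<exists>k. g $ None = k *s axis None 1)"
  proof
    assume c: "block_c g = 0"
    have "g $ None = g $ None $ None *s axis None 1"
    proof (subst vec_eq_iff, intro allI)
      fix i show "g $ None $ i = (g $ None $ None *s axis None 1) $ i"
        using c by (cases i) (auto simp: axis_def block_c_def vec_eq_iff)
    qed
    then show "\<exists>k. g $ None = k *s axis None 1" by blast
  qed (auto simp: block_c_def vec_eq_iff axis_def)
  then show ?thesis by (simp add: Aff_def)
qed

lemma AffE:
  assumes "g \<in> Aff" obtains k where "k \<noteq> 0" "g $ None = k *s axis None 1" "\<And>z. denom g z = k"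
proof -
  obtain k where k: "g $ None = k *s axis None 1" "g \<in> GL" using assms by (auto simp: Aff_iff)
  moreover have "k \<noteq> 0" using GL_row_nonzero[OF k(2), of None] k(1) by auto
  moreover have "denom g z = k" for z
    unfolding denom_row k scalar_product_smult_left
    by (simp add: scalar_product_def axis_def if_distribR if_distrib cong: if_cong)
  ultimately show ?thesis using that by blast
qed

lemma Aff_GL: "g \<in> Aff \<Longrightarrow> g \<in> GL" by (simp add: Aff_def)

lemma Aff_mult: assumes "g \<in> Aff" "h \<in> Aff" shows "g ** h \<in> Aff"
proof -
  obtain k l where "g $ None = k *s axis None 1" "h $ None = l *s axis None 1"
    using assms by (auto simp: Aff_iff)
  moreover have "axis None 1 v* h = h $ None"
    by (rule axis_vector_matrix_mult)
  ultimately have "(g ** h) $ None = (k * l) *s axis None 1"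
    by (simp add: matrix_row_mult scalar_vector_matrix_assoc vector_smult_assoc)
  then show ?thesis using assms by (auto simp: Aff_iff GL_mult)
qed

lemma Aff_inverse:
  assumes "g \<in> Aff" obtains h where "h \<in> Aff" "g ** h = mat 1" "h ** g = mat 1"
proof -
  obtain h where h: "h \<in> GL" "g ** h = mat 1" "h ** g = mat 1" using GL_inverse[OF Aff_GL[OF assms]] .
  obtain k where k: "k \<noteq> 0" "g $ None = k *s axis None 1" using AffE[OF assms] by metis
  have "axis None 1 = k *s (axis None 1 v* h)"
  proof -
    have "axis None 1 = (mat 1 :: complex ^ 'a option ^ 'a option) $ None"
      by (simp add: mat_def axis_def vec_eq_iff)
    also have "\<dots> = k *s (axis None 1 v* h)"
      unfolding h(2)[symmetric] by (simp add: matrix_row_mult k(2) scalar_vector_matrix_assoc)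
    finally show ?thesis .
  qed
  then have "(1/k) *s axis None 1 = (1/k) *s (k *s (axis None 1 v* h))" by simp
  then have "axis None 1 v* h = (1/k) *s axis None 1"
    using k(1) by (simp add: vector_smult_assoc del: vector_mul_lcancel)
  then have "h $ None = (1/k) *s axis None 1" by (simp add: axis_vector_matrix_mult)
  then have "h \<in> Aff" using h by (auto simp: Aff_iff)
  then show ?thesis using that h by blast
qed

definition no_hyperplane_mass :: "(complex ^ 'p::finite) measure \<Rightarrow> bool" where
  "no_hyperplane_mass \<mu> \<longleftrightarrow> (\<forall>s \<noteq> 0. emeasure \<mu> {z. scalar_product s (homog z) = 0} = 0)"

lemma no_hyperplane_mass_denom:
  "no_hyperplane_mass \<mu> \<Longrightarrow> g \<in> GL \<Longrightarrow> emeasure \<mu> {z. denom g z = 0} = 0"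
  by (simp add: no_hyperplane_mass_def denom_row GL_row_nonzero)

lemma no_hyperplane_mass_act:
  assumes \<mu>: "sets \<mu> = sets borel" and n: "no_hyperplane_mass \<mu>" and g: "g \<in> GL"
  shows "no_hyperplane_mass (act g \<mu>)"
  unfolding no_hyperplane_mass_def
proof (intro allI impI)
  fix s :: "complex ^ 'a option" assume s: "s \<noteq> 0"
  note [measurable_cong] = \<mu>
  have [measurable]: "(\<lambda>z. scalar_product s (homog z)) \<in> borel_measurable borel" for s :: "complex ^ 'a option"
    by (intro borel_measurable_continuous_onI continuous_intros)
  have "emeasure (act g \<mu>) {z. scalar_product s (homog z) = 0} =
    emeasure \<mu> {z. denom g z \<noteq> 0 \<and> proj_map g z \<in> {z. scalar_product s (homog z) = 0}}"
    by (rule emeasure_act[OF \<mu>]) measurable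
  also have "\<dots> \<le> emeasure \<mu> {z. scalar_product (s v* g) (homog z) = 0}"
  proof (rule emeasure_mono)
    show "{z. scalar_product (s v* g) (homog z) = 0} \<in> sets \<mu>" by measurable
  qed (auto simp: scalar_product_adjoint matrix_mult_homog scalar_product_smult_right)
  also have "\<dots> = 0" using n GL_row_mult_nonzero[OF g s] by (simp add: no_hyperplane_mass_def)
  finally show "emeasure (act g \<mu>) {z. scalar_product s (homog z) = 0} = 0" by simp
qed

lemma prob_space_act:
  assumes \<mu>: "sets \<mu> = sets borel" and n: "no_hyperplane_mass \<mu>" and g: "g \<in> GL" and "prob_space \<mu>"
  shows "prob_space (act g \<mu>)"
  unfolding act_eq_distr[OF \<mu> no_hyperplane_mass_denom[OF n g]]
proof -
  interpret prob_space \<mu> by fact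
  note [measurable_cong] = \<mu>
  show "prob_space (distr \<mu> borel (proj_map g))" by (rule prob_space_distr) measurable
qed

section \<open>Lebesgue measure under similarities\<close>

lemma nn_integral_lborel_translate:
  fixes f :: "'a::euclidean_space \<Rightarrow> ennreal"
  assumes [measurable]: "f \<in> borel_measurable borel"
  shows "(\<integral>\<^sup>+x. f (x + c) \<partial>lborel) = (\<integral>\<^sup>+x. f x \<partial>lborel)"
proof -
  have "(\<integral>\<^sup>+x. f x \<partial>lborel) = (\<integral>\<^sup>+x. f x \<partial>distr lborel borel ((+) c))"
    by (simp add: lborel_distr_plus)
  also have "\<dots> = (\<integral>\<^sup>+x. f (c + x) \<partial>lborel)"
    by (subst nn_integral_distr) auto
  finally show ?thesis by (simp add: add.commute)
qed

lemma nn_integral_lborel_reflect: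
  fixes f :: "'a::euclidean_space \<Rightarrow> ennreal"
  assumes [measurable]: "f \<in> borel_measurable borel"
  shows "(\<integral>\<^sup>+x. f (c - x) \<partial>lborel) = (\<integral>\<^sup>+x. f x \<partial>lborel)"
proof -
  have "(\<integral>\<^sup>+x. f x \<partial>lborel) = (\<integral>\<^sup>+x. f x \<partial>density (distr lborel borel (\<lambda>x. c + (-1) *\<^sub>R x)) (\<lambda>_. \<bar>(-1::real)\<bar> ^ DIM('a)))"
    using lborel_affine[of "-1" c] by simp
  also have "\<dots> = (\<integral>\<^sup>+x. f (c - x) \<partial>lborel)"
    by (simp add: density_1) (subst nn_integral_distr, auto)
  finally show ?thesis by simp
qed

text \<open>
  The reason is the uniqueness of translation invariant measures.  For the indicator \<open>g\<close> of the unit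
  ball, translation invariance and Fubini's theorem, applied to the double integral of
  \<open>f (L x) * g (y + L x)\<close>, show that the integrals of \<open>f \<circ> L\<close> and \<open>f\<close> are in the same proportion
  as those of \<open>g \<circ> L\<close> and \<open>g\<close>, and the latter are volumes of balls.  Unitary maps and multiplication
  by a complex scalar are both similarities.
\<close>

lemma nn_integral_lborel_similarity:
  fixes L :: "'a::euclidean_space \<Rightarrow> 'a" and f :: "'a \<Rightarrow> ennreal"
  assumes L: "linear L" and k: "k > 0" and norm_L: "\<And>x. norm (L x) = k * norm x"
    and [measurable]: "f \<in> borel_measurable borel"
  shows "(\<integral>\<^sup>+x. f x \<partial>lborel) = ennreal (k ^ DIM('a)) * (\<integral>\<^sup>+x. f (L x) \<partial>lborel)"
proof -
  interpret lin: linear L by fact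
  have [measurable]: "L \<in> borel_measurable borel"
    by (intro borel_measurable_continuous_onI linear_continuous_on linear_linear[THEN iffD2] L)
  have inj: "inj L"
    using norm_L k by (simp add: lin.inj_iff_eq_0) (metis less_irrefl mult_eq_0_iff norm_eq_zero)
  then have surj: "surj L" using L linear_injective_imp_surjective by blast
  define g :: "'a \<Rightarrow> ennreal" where "g = indicator (ball 0 1)"
  have [measurable]: "g \<in> borel_measurable borel" unfolding g_def by (intro borel_measurable_indicator) simp
  define V where "V = unit_ball_vol (real DIM('a))"
  have V: "V > 0" by (simp add: V_def)
  have g: "(\<integral>\<^sup>+x. g x \<partial>lborel) = ennreal V"
    unfolding g_def by (simp add: emeasure_ball V_def)
  have "g (L x) = indicator (ball 0 (1/k)) x" for x
    using k by (auto simp: g_def indicator_def norm_L field_simps)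
  then have "(\<integral>\<^sup>+x. g (L x) \<partial>lborel) = emeasure lborel (ball (0::'a) (1/k))"
    by simp
  also have "\<dots> = ennreal (V * (1/k) ^ DIM('a))"
    using k by (simp add: emeasure_ball V_def)
  finally have gL: "(\<integral>\<^sup>+x. g (L x) \<partial>lborel) = ennreal (V * (1/k) ^ DIM('a))" .
  have "(\<integral>\<^sup>+x. f (L x) \<partial>lborel) * (\<integral>\<^sup>+y. g y \<partial>lborel) 
      = (\<integral>\<^sup>+x. f (L x) * (\<integral>\<^sup>+y. g (y + L x) \<partial>lborel) \<partial>lborel)"
    by (subst nn_integral_lborel_translate) (auto simp: nn_integral_multc)
  also have "\<dots> = (\<integral>\<^sup>+x. (\<integral>\<^sup>+y. f (L x) * g (y + L x) \<partial>lborel) \<partial>lborel)"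
    by (subst nn_integral_cmult) auto
  also have "\<dots> = (\<integral>\<^sup>+y. (\<integral>\<^sup>+x. f (L x) * g (y + L x) \<partial>lborel) \<partial>lborel)"
    by (rule lborel_pair.Fubini') measurable
  also have "\<dots> = (\<integral>\<^sup>+y. (\<integral>\<^sup>+x. f (L x - y) * g (L x) \<partial>lborel) \<partial>lborel)"
  proof (rule nn_integral_cong)
    \<comment> \<open>translating \<open>x\<close> by \<open>- w\<close> moves the argument of \<open>g\<close> to \<open>L x\<close>\<close>
    fix y obtain w where w: "y = L w" using surj by blast
    have "(\<integral>\<^sup>+x. f (L x) * g (y + L x) \<partial>lborel) = (\<integral>\<^sup>+x. f (L (x + (-w))) * g (y + L (x + (-w))) \<partial>lborel)"
      by (subst nn_integral_lborel_translate) auto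
    then show "(\<integral>\<^sup>+x. f (L x) * g (y + L x) \<partial>lborel) = (\<integral>\<^sup>+x. f (L x - y) * g (L x) \<partial>lborel)"
      by (simp add: lin.diff w)
  qed
  also have "\<dots> = (\<integral>\<^sup>+x. (\<integral>\<^sup>+y. f (L x - y) * g (L x) \<partial>lborel) \<partial>lborel)"
    by (rule lborel_pair.Fubini') measurable
  also have "\<dots> = (\<integral>\<^sup>+x. (\<integral>\<^sup>+y. f (L x - y) \<partial>lborel) * g (L x) \<partial>lborel)"
    by (subst nn_integral_multc) auto
  also have "\<dots> = (\<integral>\<^sup>+x. f x \<partial>lborel) * (\<integral>\<^sup>+x. g (L x) \<partial>lborel)"
    by (subst nn_integral_lborel_reflect) (auto simp: nn_integral_cmult)
  finally have "ennreal V * (\<integral>\<^sup>+x. f (L x) \<partial>lborel) = ennreal V * ennreal ((1/k) ^ DIM('a)) * (\<integral>\<^sup>+x. f x \<partial>lborel)"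
    using V k by (simp add: g gL ennreal_mult mult_ac)
  then have "(\<integral>\<^sup>+x. f (L x) \<partial>lborel) = ennreal ((1/k) ^ DIM('a)) * (\<integral>\<^sup>+x. f x \<partial>lborel)"
    using V by (simp add: mult.assoc ennreal_mult_cancel_left)
  then have "ennreal (k ^ DIM('a)) * (\<integral>\<^sup>+x. f (L x) \<partial>lborel) = ennreal (k ^ DIM('a) * (1/k) ^ DIM('a)) * (\<integral>\<^sup>+x. f x \<partial>lborel)"
    using k by (simp add: ennreal_mult mult_ac)
  also have "k ^ DIM('a) * (1/k) ^ DIM('a) = 1"
    using k by (simp add: power_one_over)
  finally show ?thesis by simp
qed

section \<open>Unitary invariance of the standard Cauchy distribution\<close>

text \<open>
  This writes the Cauchy density as a mixture of indicators of balls centred at 0.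
\<close>

lemma nn_integral_cauchy_kernel:
  fixes n :: nat
  assumes "a \<ge> 0"
  shows "(\<integral>\<^sup>+s. ennreal ((real n + 1) / (1 + s) ^ (n + 2)) * indicator {a..} s \<partial>lborel) = ennreal (1 / (1 + a) ^ (n + 1))"
proof -
  have "(\<integral>\<^sup>+s. ennreal ((real n + 1) / (1 + s) ^ (n + 2)) * indicator {a..} s \<partial>lborel) = 0 - (- 1 / (1 + a) ^ (n + 1))"
  proof (rule nn_integral_FTC_atLeast)
    fix x :: real assume x: "a \<le> x"
    then have x: "1 + x > 0" using assms by simp
    have "((\<lambda>x. 1 / (1 + x)) has_real_derivative - (1 / (1 + x)\<^sup>2)) (at x)"
      using x by (auto intro!: derivative_eq_intros simp: power2_eq_square)
    from DERIV_minus[OF DERIV_power[OF this, of "Suc n"]]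
    have "((\<lambda>x. - ((1 / (1 + x)) ^ Suc n)) has_real_derivative
        (1 + real n) * (1 / (1 + x)\<^sup>2 * (1 / (1 + x)) ^ n)) (at x)"
      by simp
    moreover have "(1 + real n) * (1 / (1 + x)\<^sup>2 * (1 / (1 + x)) ^ n) = (real n + 1) / (1 + x) ^ (n + 2)"
      using x by (simp add: power_divide power_add power2_eq_square add.commute mult.assoc)
    ultimately show "((\<lambda>x. - 1 / (1 + x) ^ (n + 1)) has_real_derivative (real n + 1) / (1 + x) ^ (n + 2)) (at x)"
      by (simp add: power_divide)
  next
    show "((\<lambda>x. - 1 / (1 + x) ^ (n + 1)) \<longlongrightarrow> (0::real)) at_top"
      by (rule real_tendsto_divide_at_top[OF tendsto_const] filterlim_pow_at_top filterlim_tendsto_add_at_top[OF tendsto_const] filterlim_ident | simp)+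
  qed (use assms in auto)
  then show ?thesis by simp
qed

text \<open>
  The integrand is the derivative of \<open>(s / (1 + s)) ^ (n + 1)\<close>.
\<close>

lemma nn_integral_cauchy_radial:
  fixes n :: nat
  shows "(\<integral>\<^sup>+s. ennreal ((real n + 1) * s ^ n / (1 + s) ^ (n + 2)) * indicator {0..} s \<partial>lborel) = 1"
proof -
  have "(\<integral>\<^sup>+s. ennreal ((real n + 1) * s ^ n / (1 + s) ^ (n + 2)) * indicator {0..} s \<partial>lborel) = ennreal (1 - (0 / (1 + 0)) ^ (n + 1))"
  proof (rule nn_integral_FTC_atLeast)
    fix x :: real assume x: "0 \<le> x"
    have "((\<lambda>x. x / (1 + x)) has_real_derivative 1 / (1 + x)\<^sup>2) (at x)"
      using x by (auto intro!: derivative_eq_intros simp: power2_eq_square)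
    from DERIV_power[OF this, of "Suc n"]
    have "((\<lambda>x. (x / (1 + x)) ^ Suc n) has_real_derivative
       (1 + real n) * (1 / (1 + x)\<^sup>2 * (x / (1 + x)) ^ n)) (at x)"
      by simp
    moreover have "(1 + real n) * (1 / (1 + x)\<^sup>2 * (x / (1 + x)) ^ n) = (real n + 1) * x ^ n / (1 + x) ^ (n + 2)"
      using x by (simp add: power_divide power_add power2_eq_square add.commute mult.assoc)
    ultimately show "((\<lambda>x. (x / (1 + x)) ^ (n + 1)) has_real_derivative (real n + 1) * x ^ n / (1 + x) ^ (n + 2)) (at x)"
      by simp
  next
    have "((\<lambda>x::real. x / (1 + x)) \<longlongrightarrow> 1) at_top"
      by real_asymp
    from tendsto_power[OF this, of "n+1"] show "((\<lambda>x::real. (x / (1 + x)) ^ (n + 1)) \<longlongrightarrow> 1) at_top"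
      by simp
  qed auto
  then show ?thesis by simp
qed

text \<open>
  By the mixture representation the integral is the volume of the unit ball times a radial integral,
  and the latter is 1.
\<close>

lemma nn_integral_cauchy_density:
  "(\<integral>\<^sup>+z. ennreal (1 / (1 + (norm (z :: complex ^ 'p::finite))\<^sup>2) ^ (CARD('p) + 1)) \<partial>lborel)
   = ennreal (pi ^ CARD('p) / fact CARD('p))"
proof -
  let ?p = "CARD('p)"
  define k where "k s = ennreal ((real ?p + 1) / (1 + s) ^ (?p + 2))" for s :: real
  have [measurable]: "k \<in> borel_measurable borel" by (simp add: k_def[abs_def])
  have "(\<integral>\<^sup>+z. ennreal (1 / (1 + (norm (z :: complex ^ 'p))\<^sup>2) ^ (?p + 1)) \<partial>lborel)
      = (\<integral>\<^sup>+z. (\<integral>\<^sup>+s. k s * indicator {(norm (z :: complex ^ 'p))\<^sup>2..} s \<partial>lborel) \<partial>lborel)"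
    unfolding k_def by (intro nn_integral_cong nn_integral_cauchy_kernel[symmetric]) simp
  also have "\<dots> = (\<integral>\<^sup>+z. (\<integral>\<^sup>+s. k s * indicator {0..} (s - (norm (z :: complex ^ 'p))\<^sup>2) \<partial>lborel) \<partial>lborel)"
    by (intro nn_integral_cong) (auto simp: indicator_def)
  also have "\<dots> = (\<integral>\<^sup>+s. (\<integral>\<^sup>+z. k s * indicator {0..} (s - (norm (z :: complex ^ 'p))\<^sup>2) \<partial>lborel) \<partial>lborel)"
    by (rule lborel_pair.Fubini') measurable
  also have "\<dots> = (\<integral>\<^sup>+s. ennreal (unit_ball_vol (2 * ?p)) * (ennreal ((real ?p + 1) * s ^ ?p / (1 + s) ^ (?p + 2)) * indicator {0..} s) \<partial>lborel)"
  proof (intro nn_integral_cong)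
    fix s :: real
    show "(\<integral>\<^sup>+z. k s * indicator {0..} (s - (norm (z :: complex ^ 'p))\<^sup>2) \<partial>lborel) =
      ennreal (unit_ball_vol (2 * ?p)) * (ennreal ((real ?p + 1) * s ^ ?p / (1 + s) ^ (?p + 2)) * indicator {0..} s)"
    proof (cases "s \<ge> 0")
      case True
      have "norm z \<le> sqrt s \<longleftrightarrow> (norm z)\<^sup>2 \<le> s" for z :: "complex ^ 'p"
        by (metis abs_norm_cancel real_sqrt_abs real_sqrt_le_iff)
      then have "(indicator {0..} (s - (norm z)\<^sup>2) :: ennreal) = indicator (cball 0 (sqrt s)) z" for z :: "complex ^ 'p"
        by (auto simp: indicator_def dist_norm)
      then have "(\<integral>\<^sup>+z. k s * indicator {0..} (s - (norm (z :: complex ^ 'p))\<^sup>2) \<partial>lborel) = k s * emeasure lborel (cball (0::complex ^ 'p) (sqrt s))"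
        by (simp only: nn_integral_cmult_indicator borel_closed closed_cball sets_lborel)
      also have "emeasure lborel (cball (0::complex ^ 'p) (sqrt s)) = ennreal (unit_ball_vol (2 * ?p) * s ^ ?p)"
      proof -
        have "sqrt s ^ (2 * ?p) = s ^ ?p" using True by (simp add: power_mult)
        then show ?thesis using True by (simp add: emeasure_cball mult.commute[of _ 2])
      qed
      finally show ?thesis using True by (simp add: k_def ennreal_mult[symmetric] mult_ac)
    next
      case False
      then have "s - (norm z)\<^sup>2 < 0" for z :: "complex ^ 'p" by (smt (verit) zero_le_power2)
      then show ?thesis using False by (auto simp: indicator_def not_le[symmetric])
    qed
  qed
  also have "\<dots> = ennreal (unit_ball_vol (2 * ?p))"
    by (subst nn_integral_cmult) (simp_all only: nn_integral_cauchy_radial mult_1_right, measurable)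
  also have "unit_ball_vol (2 * ?p) = pi ^ ?p / fact ?p"
    using unit_ball_vol_even[of ?p] by simp
  finally show ?thesis .
qed

lemma sets_std_cauchy [simp, measurable_cong]: "sets std_cauchy = sets borel"
  by (simp add: std_cauchy_def)

lemma space_std_cauchy [simp]: "space std_cauchy = UNIV"
  by (simp add: std_cauchy_def)

lemma emeasure_std_cauchy:
  fixes X :: "(complex ^ 'p::finite) set"
  assumes [measurable]: "X \<in> sets borel"
  shows "emeasure std_cauchy X = ennreal (fact CARD('p) / pi ^ CARD('p)) *
    (\<integral>\<^sup>+z. ennreal (1 / (1 + (norm z)\<^sup>2) ^ (CARD('p) + 1)) * indicator X z \<partial>lborel)"
proof -
  have "Gamma (real CARD('p) + 1) = fact CARD('p)"
    using Gamma_fact[of "CARD('p)", where 'a=real] by (simp add: add.commute)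
  then have "Gamma (real CARD('p) + 1) / (pi ^ CARD('p) * (1 + (norm z)\<^sup>2) ^ (CARD('p) + 1)) =
     (fact CARD('p) / pi ^ CARD('p)) * (1 / (1 + (norm z)\<^sup>2) ^ (CARD('p) + 1))" for z :: "complex ^ 'p"
    by simp
  then have density: "ennreal (Gamma (real CARD('p) + 1) / (pi ^ CARD('p) * (1 + (norm z)\<^sup>2) ^ (CARD('p) + 1))) =
     ennreal (fact CARD('p) / pi ^ CARD('p)) * ennreal (1 / (1 + (norm z)\<^sup>2) ^ (CARD('p) + 1))" for z :: "complex ^ 'p"
    by (simp only: ennreal_mult' fact_ge_zero divide_nonneg_nonneg zero_le_power pi_ge_zero)
  have "emeasure std_cauchy X = (\<integral>\<^sup>+z. ennreal (fact CARD('p) / pi ^ CARD('p)) *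
      (ennreal (1 / (1 + (norm z)\<^sup>2) ^ (CARD('p) + 1)) * indicator X z) \<partial>lborel)"
    unfolding std_cauchy_def density
    by (subst emeasure_density) (simp_all only: mult.assoc assms sets_lborel, measurable)
  also have "\<dots> = ennreal (fact CARD('p) / pi ^ CARD('p)) *
    (\<integral>\<^sup>+z. ennreal (1 / (1 + (norm z)\<^sup>2) ^ (CARD('p) + 1)) * indicator X z \<partial>lborel)"
    by (rule nn_integral_cmult) measurable
  finally show ?thesis .
qed

lemma prob_space_std_cauchy: "prob_space (std_cauchy :: (complex ^ 'p::finite) measure)"
proof
  have "emeasure (std_cauchy :: (complex ^ 'p) measure) UNIV = ennreal (fact CARD('p) / pi ^ CARD('p)) * ennreal (pi ^ CARD('p) / fact CARD('p))"
    using emeasure_std_cauchy[of "UNIV :: (complex ^ 'p) set", OF borel_open[OF open_UNIV]]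
    by (simp only: indicator_UNIV mult_1_right nn_integral_cauchy_density)
  also have "\<dots> = 1" by (simp add: ennreal_mult[symmetric])
  finally show "emeasure (std_cauchy :: (complex ^ 'p) measure) (space std_cauchy) = 1" by simp
qed

lemma linear_smult: "linear (\<lambda>z :: complex ^ 'n::finite. t *s z)"
  by (rule linearI) (simp_all add: vec_eq_iff algebra_simps)

text \<open>
  The part inside the unit ball of the union of the complex lines through the points \<open>(z, 1)\<close> with
  \<open>z \<in> X\<close>.
\<close>

definition cone_over :: "(complex ^ 'p::finite) set \<Rightarrow> ((complex ^ 'p) \<times> complex) set" where
  "cone_over X = {(w, t). t \<noteq> 0 \<and> (1 / t) *s w \<in> X \<and> norm (w, t) < 1}"

lemma mem_cone_over: "Y \<in> cone_over X \<longleftrightarrow> snd Y \<noteq> 0 \<and> (1 / snd Y) *s fst Y \<in> X \<and> norm Y < 1"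
  by (cases Y) (simp add: cone_over_def)

lemma cone_over_measurable [measurable]:
  fixes X :: "(complex ^ 'p::finite) set"
  assumes [measurable]: "X \<in> sets borel" shows "cone_over X \<in> sets borel"
proof -
  have [measurable]: "(fst :: (complex ^ 'p) \<times> complex \<Rightarrow> _) \<in> borel_measurable borel"
    "(snd :: (complex ^ 'p) \<times> complex \<Rightarrow> _) \<in> borel_measurable borel"
    by (intro borel_measurable_continuous_onI continuous_intros)+
  have "{Y :: (complex ^ 'p) \<times> complex. snd Y \<noteq> 0 \<and> (1 / snd Y) *s fst Y \<in> X \<and> norm Y < 1} \<in> sets borel"
    by measurable
  also have "{Y :: (complex ^ 'p) \<times> complex. snd Y \<noteq> 0 \<and> (1 / snd Y) *s fst Y \<in> X \<and> norm Y < 1} = cone_over X"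
    by (auto simp: cone_over_def)
  finally show ?thesis .
qed

text \<open>
  On the slice with last coordinate \<open>t\<close> the substitution \<open>w = t z\<close> produces the factor
  \<open>norm t ^ (2 p)\<close>; for fixed \<open>z\<close> the substitution of \<open>t / sqrt (1 + norm z ^ 2)\<close> for \<open>t\<close> then
  separates the two variables and produces the Cauchy density.
\<close>

lemma emeasure_cone_over:
  fixes X :: "(complex ^ 'p::finite) set"
  assumes [measurable]: "X \<in> sets borel"
  shows "emeasure lborel (cone_over X) =
    (\<integral>\<^sup>+z. ennreal (1 / (1 + (norm z)\<^sup>2) ^ (CARD('p) + 1)) * indicator X z \<partial>lborel) *
    (\<integral>\<^sup>+t. ennreal (norm (t::complex) ^ (2 * CARD('p))) * indicator (ball 0 1) t \<partial>lborel)"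
proof -
  let ?p = "CARD('p)"
  define C where "C = (\<integral>\<^sup>+t. ennreal (norm (t::complex) ^ (2 * ?p)) * indicator (ball 0 1) t \<partial>lborel)"
  define D where "D z t = (indicator {..<1} ((norm t)\<^sup>2 * (1 + (norm z)\<^sup>2)) :: ennreal)" for z :: "complex ^ 'p" and t :: complex
  have [measurable]: "ball (0::complex) 1 \<in> sets borel" by simp
  have [measurable]: "case_prod D \<in> borel_measurable (borel \<Otimes>\<^sub>M borel)"
    unfolding D_def by measurable
  have [measurable]: "cone_over X \<in> sets (borel \<Otimes>\<^sub>M borel)"
    unfolding borel_prod by measurable
  have "emeasure lborel (cone_over X) = emeasure (lborel \<Otimes>\<^sub>M lborel) (cone_over X)"
    by (simp add: lborel_prod)
  also have "\<dots> = (\<integral>\<^sup>+Y. indicator (cone_over X) Y \<partial>(lborel \<Otimes>\<^sub>M lborel))"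
    by (rule nn_integral_indicator[symmetric]) measurable
  also have "\<dots> = (\<integral>\<^sup>+t. (\<integral>\<^sup>+w. indicator (cone_over X) (w, t) \<partial>lborel) \<partial>lborel)"
    by (rule lborel_pair.nn_integral_snd[symmetric]) measurable
  also have "\<dots> = (\<integral>\<^sup>+t. (\<integral>\<^sup>+z. ennreal (norm t ^ (2 * ?p)) * D z t * indicator X z \<partial>lborel) \<partial>lborel)"
  proof (rule nn_integral_cong)
    fix t :: complex
    show "(\<integral>\<^sup>+w. indicator (cone_over X) (w, t) \<partial>lborel) = (\<integral>\<^sup>+z. ennreal (norm t ^ (2 * ?p)) * D z t * indicator X z \<partial>lborel)"
    proof (cases "t = 0")
      case False
      have "(\<integral>\<^sup>+w. indicator (cone_over X) (w, t) \<partial>lborel) =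
          ennreal (norm t ^ DIM(complex ^ 'p)) * (\<integral>\<^sup>+z. indicator (cone_over X) (t *s z, t) \<partial>lborel)"
        using False by (intro nn_integral_lborel_similarity) (auto simp: linear_smult norm_smult, measurable)
      also have "\<dots> = (\<integral>\<^sup>+z. ennreal (norm t ^ (2 * ?p)) * indicator (cone_over X) (t *s z, t) \<partial>lborel)"
        by (subst nn_integral_cmult) (auto simp: mult.commute, measurable)
      also have "\<dots> = (\<integral>\<^sup>+z. ennreal (norm t ^ (2 * ?p)) * D z t * indicator X z \<partial>lborel)"
      proof (rule nn_integral_cong)
        fix z :: "complex ^ 'p"
        have "(norm (t *s z, t))\<^sup>2 = (norm t)\<^sup>2 * (1 + (norm z)\<^sup>2)"
          by (simp add: norm_prod_def norm_smult power_mult_distrib algebra_simps)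
        moreover have "norm (t *s z, t) < 1 \<longleftrightarrow> (norm (t *s z, t))\<^sup>2 < 1"
          by (simp add: abs_square_less_1)
        ultimately have "indicator (cone_over X) (t *s z, t) = D z t * indicator X z"
          using False by (auto simp: cone_over_def D_def indicator_def)
        then show "ennreal (norm t ^ (2 * ?p)) * indicator (cone_over X) (t *s z, t) = ennreal (norm t ^ (2 * ?p)) * D z t * indicator X z"
          by (simp add: mult.assoc)
      qed
      finally show ?thesis .
    qed (simp add: cone_over_def zero_power)
  qed
  also have "\<dots> = (\<integral>\<^sup>+z. (\<integral>\<^sup>+t. ennreal (norm t ^ (2 * ?p)) * D z t * indicator X z \<partial>lborel) \<partial>lborel)"
    by (rule lborel_pair.Fubini') measurable
  also have "\<dots> = (\<integral>\<^sup>+z. ennreal (1 / (1 + (norm z)\<^sup>2) ^ (?p + 1)) * indicator X z * C \<partial>lborel)"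
  proof (rule nn_integral_cong)
    fix z :: "complex ^ 'p"
    define a where "a = 1 / sqrt (1 + (norm z)\<^sup>2)"
    have pos: "1 + (norm z)\<^sup>2 > 0" by (simp add: add_pos_nonneg)
    have a: "a > 0" "a\<^sup>2 * (1 + (norm z)\<^sup>2) = 1" using pos by (simp_all add: a_def power_divide)
    have "(\<integral>\<^sup>+t. ennreal (norm t ^ (2 * ?p)) * D z t \<partial>lborel) =
       ennreal (a ^ DIM(complex)) * (\<integral>\<^sup>+t. ennreal (norm (a *\<^sub>R t) ^ (2 * ?p)) * D z (a *\<^sub>R t) \<partial>lborel)"
      using a by (intro nn_integral_lborel_similarity) (auto intro: linear_scaleR, measurable)
    also have "(\<integral>\<^sup>+t. ennreal (norm (a *\<^sub>R t) ^ (2 * ?p)) * D z (a *\<^sub>R t) \<partial>lborel) = 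
       (\<integral>\<^sup>+t. ennreal (a ^ (2 * ?p)) * (ennreal (norm (t :: complex) ^ (2 * ?p)) * indicator (ball 0 1) t) \<partial>lborel)"
    proof (rule nn_integral_cong)
      fix t :: complex
      have "(norm (a *\<^sub>R t))\<^sup>2 * (1 + (norm z)\<^sup>2) = (a\<^sup>2 * (1 + (norm z)\<^sup>2)) * (norm t)\<^sup>2"
        by (simp add: power_mult_distrib)
      then have "D z (a *\<^sub>R t) = indicator (ball 0 1) t"
        by (simp add: D_def a indicator_def abs_square_less_1)
      then show "ennreal (norm (a *\<^sub>R t) ^ (2 * ?p)) * D z (a *\<^sub>R t) = ennreal (a ^ (2 * ?p)) * (ennreal (norm t ^ (2 * ?p)) * indicator (ball 0 1) t)"
        using a(1) by (simp add: power_mult_distrib ennreal_mult mult.assoc)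
    qed
    also have "\<dots> = ennreal (a ^ (2 * ?p)) * C"
      unfolding C_def by (rule nn_integral_cmult) measurable
    also have "ennreal (a ^ DIM(complex)) * (ennreal (a ^ (2 * ?p)) * C) = ennreal ((a\<^sup>2) ^ (?p + 1)) * C"
      using a(1) by (simp add: ennreal_mult[symmetric] mult.assoc[symmetric] power_mult[symmetric] power_add[symmetric])
    also have "a\<^sup>2 = 1 / (1 + (norm z)\<^sup>2)" using a(2) pos by (simp add: field_simps)
    finally have "(\<integral>\<^sup>+t. ennreal (norm t ^ (2 * ?p)) * D z t \<partial>lborel) = ennreal (1 / (1 + (norm z)\<^sup>2) ^ (?p + 1)) * C"
      by (simp only: power_one_over)
    then show "(\<integral>\<^sup>+t. ennreal (norm t ^ (2 * ?p)) * D z t * indicator X z \<partial>lborel) = ennreal (1 / (1 + (norm z)\<^sup>2) ^ (?p + 1)) * indicator X z * C"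
      by (subst nn_integral_multc) (auto simp: mult_ac simp del: power_Suc)
  qed
  also have "\<dots> = (\<integral>\<^sup>+z. ennreal (1 / (1 + (norm z)\<^sup>2) ^ (?p + 1)) * indicator X z \<partial>lborel) * C"
    by (rule nn_integral_multc) measurable
  finally show ?thesis by (simp only: C_def)
qed

lemma AE_snd_nonzero: "AE Y in (lborel :: ((complex ^ 'p::finite) \<times> complex) measure). snd Y \<noteq> 0"
proof (rule AE_I')
  have "emeasure ((lborel :: (complex ^ 'p) measure) \<Otimes>\<^sub>M lborel) (UNIV \<times> {0::complex}) = 0"
    by (subst lborel.emeasure_pair_measure_Times) auto
  then show "UNIV \<times> {0} \<in> null_sets (lborel :: ((complex ^ 'p) \<times> complex) measure)"
    unfolding lborel_prod by (intro null_setsI) (auto intro!: borel_closed closed_Times)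
qed (auto simp: prod_eq_iff)

text \<open>
  The integral over the unit disc in \<open>emeasure_cone_over\<close> is positive and finite, as one sees by taking
  for \<open>X\<close> the whole space, whose cone is the unit ball up to a null set.  So it can be moved to the
  other side.
\<close>

lemma std_cauchy_cone_over:
  obtains c where "\<And>X :: (complex ^ 'p::finite) set. X \<in> sets borel \<Longrightarrow>
    emeasure std_cauchy X = ennreal c * emeasure lborel (cone_over X)"
proof -
  let ?p = "CARD('p)"
  define C where "C = (\<integral>\<^sup>+t. ennreal (norm (t::complex) ^ (2 * ?p)) * indicator (ball 0 1) t \<partial>lborel)"
  have "emeasure lborel (cone_over (UNIV :: (complex ^ 'p) set)) = emeasure lborel (ball (0 :: (complex ^ 'p) \<times> complex) 1)"
  proof (rule emeasure_eq_AE)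
    show "AE Y in lborel. (Y \<in> cone_over (UNIV :: (complex ^ 'p) set)) = (Y \<in> ball 0 1)"
      using AE_snd_nonzero by eventually_elim (auto simp: cone_over_def)
  qed (auto intro: cone_over_measurable)
  also have "\<dots> = ennreal (unit_ball_vol DIM((complex ^ 'p) \<times> complex))"
    by (simp add: emeasure_ball)
  finally have ball: "ennreal (pi ^ ?p / fact ?p) * C = ennreal (unit_ball_vol DIM((complex ^ 'p) \<times> complex))"
    by (subst (asm) emeasure_cone_over) (simp_all only: indicator_UNIV mult_1_right nn_integral_cauchy_density C_def[symmetric], simp)
  have V: "unit_ball_vol (real DIM((complex ^ 'p) \<times> complex)) > 0" by (rule unit_ball_vol_pos) simp
  have "C \<noteq> 0"
  proof
    assume "C = 0"
    with ball have "ennreal (unit_ball_vol (real DIM((complex ^ 'p) \<times> complex))) = 0"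
      by (simp only: mult_zero_right)
    with V show False by (simp only: ennreal_eq_0_iff)
  qed
  moreover have "C \<noteq> \<infinity>" using ball by (auto simp: ennreal_mult_top simp del: DIM_prod)
  ultimately obtain r where r: "r > 0" "C = ennreal r"
    by (cases C) auto
  show thesis
  proof (rule that)
    fix X :: "(complex ^ 'p) set" assume X: "X \<in> sets borel"
    show "emeasure std_cauchy X = ennreal (fact ?p / pi ^ ?p / r) * emeasure lborel (cone_over X)"
      unfolding emeasure_cone_over[OF X] emeasure_std_cauchy[OF X] C_def[symmetric] r(2)
      using r(1) by (simp add: mult.left_commute[of _ _ "ennreal r"] mult.assoc[symmetric] ennreal_mult[symmetric] mult.commute[of _ "ennreal r"] del: power_Suc)
  qed
qed

text \<open>
  Fubini's theorem is applied on the product of \<open>p\<close>-space and the complex line, whereas matrices act on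
  vectors with the additional index \<open>None\<close>; \<open>split_last\<close> and \<open>join_last\<close> pass between the two.
\<close>

definition split_last :: "complex ^ 'p::finite option \<Rightarrow> (complex ^ 'p) \<times> complex" where
  "split_last v = (\<chi> j. v $ Some j, v $ None)"

definition join_last :: "(complex ^ 'p::finite) \<times> complex \<Rightarrow> complex ^ 'p option" where
  "join_last Y = (\<chi> i. case i of None \<Rightarrow> snd Y | Some j \<Rightarrow> fst Y $ j)"

lemma join_last_nth [simp]: "join_last Y $ None = snd Y" "join_last Y $ Some j = fst Y $ j"
  by (simp_all add: join_last_def)

lemma norm_join_last: "norm (join_last Y) = norm Y"
  by (cases Y) (simp add: norm_vec_def L2_set_def sum_UNIV_option norm_prod_def sum_nonneg add.commute)

lemma join_split_last: "join_last (split_last v) = v"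
proof (subst vec_eq_iff, intro allI)
  fix i show "join_last (split_last v) $ i = v $ i" by (cases i) (simp_all add: split_last_def)
qed

lemma norm_split_last: "norm (split_last v) = norm v"
  using norm_join_last[of "split_last v"] by (simp add: join_split_last)

text \<open>
  A unitary matrix maps the cone over the preimage of \<open>X\<close> to the cone over \<open>X\<close> up to a null set, and it
  preserves Lebesgue measure.
\<close>

lemma act_unitary_std_cauchy:
  fixes u :: "complex ^ 'p::finite option ^ 'p option"
  assumes u: "unitary u"
  shows "act u std_cauchy = std_cauchy"
proof (rule measure_eqI)
  fix X assume "X \<in> sets (act u std_cauchy)"
  then have [measurable]: "X \<in> sets borel" by simp
  define L where "L Y = split_last (u *v join_last Y)" for Y :: "(complex ^ 'p) \<times> complex"
  have join_L: "join_last (L Y) = u *v join_last Y" for Y by (simp add: L_def join_split_last)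
  have "linear L"
  proof (rule linearI)
    fix Y Z :: "(complex ^ 'p) \<times> complex" and r :: real
    have "join_last (Y + Z) = join_last Y + join_last Z" "join_last (r *\<^sub>R Y) = r *\<^sub>R join_last Y"
      by (auto simp: join_last_def vec_eq_iff split: option.splits)
    moreover have "split_last (v + w) = split_last v + split_last w" "split_last (r *\<^sub>R v) = r *\<^sub>R split_last v"
      for v w :: "complex ^ 'p option"
      by (simp_all add: split_last_def vec_eq_iff)
    ultimately show "L (Y + Z) = L Y + L Z" "L (r *\<^sub>R Y) = r *\<^sub>R L Y"
      by (simp_all add: L_def matrix_vector_right_distrib linear_scale[OF matrix_vector_mul_linear])
  qed
  have norm_L: "norm (L Y) = norm Y" for Y
    by (simp add: L_def norm_split_last unitary_norm[OF u] norm_join_last)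
  \<comment> \<open>\<open>L\<close> is \<open>u\<close> in the coordinates in which the cones are defined\<close>
  define X' where "X' = {z. denom u z \<noteq> 0 \<and> proj_map u z \<in> X}"
  have [measurable]: "X' \<in> sets borel" unfolding X'_def by measurable
  have *: "Y \<in> cone_over X' \<longleftrightarrow> L Y \<in> cone_over X" if Y: "snd Y \<noteq> 0" for Y
  proof -
    let ?z = "(1 / snd Y) *s fst Y"
    have "homog ?z = (1 / snd Y) *s join_last Y"
    proof (subst vec_eq_iff, intro allI)
      fix i show "homog ?z $ i = ((1 / snd Y) *s join_last Y) $ i" using Y by (cases i) simp_all
    qed
    then have eq: "u *v homog ?z = (1 / snd Y) *s join_last (L Y)"
      by (simp add: join_L vec.scale)
    have d: "denom u ?z = snd (L Y) / snd Y" by (simp add: denom_homog eq)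
    have p: "proj_map u ?z = (1 / snd (L Y)) *s fst (L Y)" if nz: "snd (L Y) \<noteq> 0"
    proof -
      have "denom u ?z *s homog (proj_map u ?z) = (1 / snd Y) *s join_last (L Y)"
        using matrix_mult_homog[of u ?z] eq d nz Y by simp
      then have "denom u ?z * proj_map u ?z $ j = (1 / snd Y) * fst (L Y) $ j" for j
        by (metis homog_nth(2) join_last_nth(2) vector_smult_component)
      then show ?thesis using nz Y by (simp add: vec_eq_iff d field_simps)
    qed
    then show ?thesis
      unfolding mem_cone_over X'_def using Y by (cases "snd (L Y) = 0") (simp_all add: d p norm_L)
  qed
  have "emeasure lborel (cone_over X) = (\<integral>\<^sup>+Y. indicator (cone_over X) Y \<partial>lborel)"
    by (rule nn_integral_indicator[symmetric]) measurable
  also have "\<dots> = ennreal (1 ^ DIM((complex ^ 'p) \<times> complex)) * (\<integral>\<^sup>+Y. indicator (cone_over X) (L Y) \<partial>lborel)"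
    by (rule nn_integral_lborel_similarity) (auto simp: norm_L \<open>linear L\<close>, measurable)
  also have "\<dots> = (\<integral>\<^sup>+Y. indicator (cone_over X) (L Y) \<partial>lborel)" by simp
  also have "\<dots> = (\<integral>\<^sup>+Y. indicator (cone_over X') Y \<partial>lborel)"
    using AE_snd_nonzero by (intro nn_integral_cong_AE, eventually_elim) (auto simp: * indicator_def)
  also have "\<dots> = emeasure lborel (cone_over X')"
    by (rule nn_integral_indicator) measurable
  finally have cone: "emeasure lborel (cone_over X') = emeasure lborel (cone_over X)" ..
  obtain c where c: "\<And>X :: (complex ^ 'p) set. X \<in> sets borel \<Longrightarrow>
    emeasure std_cauchy X = ennreal c * emeasure lborel (cone_over X)"
    using std_cauchy_cone_over by blast
  have "emeasure (act u std_cauchy) X = emeasure std_cauchy X'"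
    unfolding X'_def by (rule emeasure_act) auto
  then show "emeasure (act u std_cauchy) X = emeasure std_cauchy X"
    by (simp add: c cone)
qed simp

lemma emeasure_std_cauchy_pos:
  fixes U :: "(complex ^ 'p::finite) set"
  assumes U: "open U" "U \<noteq> {}"
  shows "emeasure std_cauchy U > 0"
proof -
  let ?f = "\<lambda>z :: complex ^ 'p. ennreal (1 / (1 + (norm z)\<^sup>2) ^ (CARD('p) + 1)) * indicator U z"
  have [measurable]: "U \<in> sets borel" using U by simp
  have "(\<integral>\<^sup>+z. ?f z \<partial>lborel) \<noteq> 0"
  proof
    assume "(\<integral>\<^sup>+z. ?f z \<partial>lborel) = 0"
    then have AE0: "AE z in lborel. ?f z = 0" by (subst (asm) nn_integral_0_iff_AE) auto
    have f0: "?f z = 0 \<Longrightarrow> z \<notin> U" for z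
    proof -
      have "0 < 1 / (1 + (norm z)\<^sup>2) ^ (CARD('p) + 1)"
        by (intro divide_pos_pos zero_less_power add_pos_nonneg) auto
      then have "ennreal (1 / (1 + (norm z)\<^sup>2) ^ (CARD('p) + 1)) \<noteq> 0"
        by (simp only: ennreal_eq_0_iff not_le)
      then show "?f z = 0 \<Longrightarrow> z \<notin> U" by (cases "z \<in> U") (simp_all only: indicator_simps mult_1_right not_True_eq_False not_False_eq_True)
    qed
    from AE0 have "AE z in lborel. z \<notin> U" by eventually_elim (rule f0)
    then have "emeasure lborel U = 0" by (subst (asm) AE_iff_measurable[OF _ refl]) auto
    moreover obtain x r where "r > 0" "ball x r \<subseteq> U"
      using U open_contains_ball by (metis ex_in_conv)
    moreover have "emeasure lborel (ball x r) \<le> emeasure lborel U"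
      using \<open>ball x r \<subseteq> U\<close> by (intro emeasure_mono) auto
    ultimately have "emeasure lborel (ball x r) = 0" and r: "r > 0" by auto
    then have "unit_ball_vol (real DIM(complex ^ 'p)) * r ^ DIM(complex ^ 'p) \<le> 0"
      by (simp only: emeasure_ball less_imp_le ennreal_eq_0_iff)
    moreover have "unit_ball_vol (real DIM(complex ^ 'p)) * r ^ DIM(complex ^ 'p) > 0"
      using r by (intro mult_pos_pos unit_ball_vol_pos zero_less_power) auto
    ultimately show False by linarith
  qed
  then show ?thesis
    by (subst emeasure_std_cauchy) (auto simp: ennreal_zero_less_mult_iff zero_less_iff_neq_zero)
qed

section \<open>Uniformly distributed measures\<close>

lemma indicator_sublevel_measurable:
  fixes d :: "'a::topological_space \<Rightarrow> 'a \<Rightarrow> real"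
  assumes [measurable]: "case_prod d \<in> borel_measurable (borel \<Otimes>\<^sub>M borel)"
  shows "(\<lambda>(x,y). indicator {y. d x y < \<epsilon>} y :: ennreal) \<in> borel_measurable (borel \<Otimes>\<^sub>M borel)"
proof -
  have "{z \<in> space (borel \<Otimes>\<^sub>M borel). case_prod d z < \<epsilon>} \<in> sets (borel \<Otimes>\<^sub>M borel)"
    by measurable
  then have "(indicator {z. case_prod d z < \<epsilon>} :: _ \<Rightarrow> ennreal) \<in> borel_measurable (borel \<Otimes>\<^sub>M borel)"
    by (simp add: space_pair_measure)
  moreover have "(\<lambda>(x,y). indicator {y. d x y < \<epsilon>} y :: ennreal) = indicator {z. case_prod d z < \<epsilon>}"
    by (auto simp: indicator_def fun_eq_iff)
  ultimately show ?thesis by simp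
qed

text \<open>
  Christensen's argument.  For \<open>x \<in> U\<close> the relative \<open>\<nu>\<close>-mass of \<open>U\<close> in small balls about \<open>x\<close> tends
  to 1, so Fatou's lemma bounds \<open>\<mu> U\<close> by the limit inferior of its \<open>\<mu>\<close>-integrals.  By Fubini's theorem
  and symmetry of \<open>d\<close>, each of these integrals counts every point of \<open>U\<close> with the \<open>\<mu>\<close>-mass of a ball
  divided by the \<open>\<nu>\<close>-mass of a ball of the same radius, so it equals \<open>\<nu> U\<close>.
\<close>

lemma uniformly_distributed_le:
  fixes \<mu> \<nu> :: "'a::second_countable_topology measure" and d :: "'a \<Rightarrow> 'a \<Rightarrow> real"
  assumes "finite_measure \<mu>" "finite_measure \<nu>" and [simp]: "sets \<mu> = sets borel" "sets \<nu> = sets borel"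
    and d[measurable]: "case_prod d \<in> borel_measurable (borel \<Otimes>\<^sub>M borel)"
    and sym: "\<And>x y. d x y = d y x"
    and small: "\<And>U x. open U \<Longrightarrow> x \<in> U \<Longrightarrow> \<exists>\<epsilon>>0. \<forall>y. d x y < \<epsilon> \<longrightarrow> y \<in> U"
    and const: "\<And>x \<epsilon>. \<epsilon> > 0 \<Longrightarrow> emeasure \<mu> {y. d x y < \<epsilon>} = b \<epsilon>"
      "\<And>x \<epsilon>. \<epsilon> > 0 \<Longrightarrow> emeasure \<nu> {y. d x y < \<epsilon>} = b \<epsilon>"
    and pos: "\<And>\<epsilon>. \<epsilon> > 0 \<Longrightarrow> b \<epsilon> > 0"
    and U: "open U"
  shows "emeasure \<mu> U \<le> emeasure \<nu> U"
proof -
  interpret M: finite_measure \<mu> by fact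
  interpret N: finite_measure \<nu> by fact
  interpret P: pair_sigma_finite \<mu> \<nu> by unfold_locales
  note [measurable_cong] = assms(3,4)
  have [measurable]: "U \<in> sets borel" using U by simp
  have bfin: "b \<epsilon> \<noteq> \<infinity>" if "\<epsilon> > 0" for \<epsilon>
    using const(2)[OF that, of undefined] N.emeasure_finite by (metis infinity_ennreal_def)
  define e where "e n = 1 / (real n + 1)" for n :: nat
  have e: "e n > 0" for n by (simp add: e_def)
  define f where "f n x = emeasure \<nu> (U \<inter> {y. d x y < e n}) / b (e n)" for n x
  have f_eq: "f n x = (\<integral>\<^sup>+y. indicator U y * indicator {y. d x y < e n} y \<partial>\<nu>) / b (e n)" for n x
  proof -
    have "U \<inter> {y. d x y < e n} \<in> sets \<nu>" by measurable
    then have "emeasure \<nu> (U \<inter> {y. d x y < e n}) = (\<integral>\<^sup>+y. indicator (U \<inter> {y. d x y < e n}) y \<partial>\<nu>)"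
      by (subst nn_integral_indicator) auto
    then show ?thesis by (simp add: f_def indicator_inter_arith)
  qed
  note [measurable] = indicator_sublevel_measurable[OF d]
  have [measurable]: "f n \<in> borel_measurable \<mu>" for n
    unfolding f_eq by measurable
  have int_f: "(\<integral>\<^sup>+x. f n x \<partial>\<mu>) = emeasure \<nu> U" for n
  proof -
    have "(\<integral>\<^sup>+x. f n x \<partial>\<mu>) = (\<integral>\<^sup>+x. \<integral>\<^sup>+y. indicator U y * indicator {y. d x y < e n} y \<partial>\<nu> \<partial>\<mu>) / b (e n)"
      unfolding f_eq by (subst nn_integral_divide) auto
    also have "(\<integral>\<^sup>+x. \<integral>\<^sup>+y. indicator U y * indicator {y. d x y < e n} y \<partial>\<nu> \<partial>\<mu>) 
        = (\<integral>\<^sup>+y. \<integral>\<^sup>+x. indicator U y * indicator {y. d x y < e n} y \<partial>\<mu> \<partial>\<nu>)"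
      by (rule P.Fubini'[symmetric]) measurable
    also have "\<dots> = (\<integral>\<^sup>+y. indicator U y * b (e n) \<partial>\<nu>)"
    proof (rule nn_integral_cong)
      fix y
      have "{x. d y x < e n} \<in> sets \<mu>" by measurable
      then have "(\<integral>\<^sup>+x. indicator {x. d y x < e n} x \<partial>\<mu>) = b (e n)"
        by (subst nn_integral_indicator) (auto simp: const e)
      moreover have "indicator {y. d x y < e n} y = (indicator {x. d y x < e n} x :: ennreal)" for x
        by (auto simp: indicator_def sym)
      ultimately show "(\<integral>\<^sup>+x. indicator U y * indicator {y. d x y < e n} y \<partial>\<mu>) = indicator U y * b (e n)"
        by (auto simp: indicator_def)
    qed
    also have "\<dots> = emeasure \<nu> U * b (e n)" by (simp add: nn_integral_multc)
    finally show ?thesis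
      using pos[OF e[of n]] bfin[OF e[of n]] by (simp add: ennreal_mult_divide_eq)
  qed
  have lim: "indicator U x \<le> liminf (\<lambda>n. f n x)" for x
  proof (cases "x \<in> U")
    case True
    obtain \<epsilon> where \<epsilon>: "\<epsilon> > 0" "\<And>y. d x y < \<epsilon> \<Longrightarrow> y \<in> U" using small[OF U True] by blast
    have "eventually (\<lambda>n. e n < \<epsilon>) sequentially"
      unfolding e_def by (rule order_tendstoD[of _ 0]) (use \<epsilon> LIMSEQ_inverse_real_of_nat in \<open>auto simp: inverse_eq_divide add.commute\<close>)
    then have "eventually (\<lambda>n. 1 \<le> f n x) sequentially"
    proof eventually_elim
      case (elim n)
      have "U \<inter> {y. d x y < e n} = {y. d x y < e n}" using \<epsilon> elim by auto
      then show ?case using pos[OF e[of n]] bfin[OF e[of n]]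
        by (simp add: f_def const e ennreal_divide_self less_top)
    qed
    then show ?thesis using True by (simp add: Liminf_bounded)
  qed simp
  have "emeasure \<mu> U = (\<integral>\<^sup>+x. indicator U x \<partial>\<mu>)" by (simp add: nn_integral_indicator)
  also have "\<dots> \<le> (\<integral>\<^sup>+x. liminf (\<lambda>n. f n x) \<partial>\<mu>)" by (intro nn_integral_mono lim)
  also have "\<dots> \<le> liminf (\<lambda>n. \<integral>\<^sup>+x. f n x \<partial>\<mu>)" by (rule nn_integral_liminf) measurable
  also have "\<dots> = emeasure \<nu> U" by (simp add: int_f Liminf_const)
  finally show ?thesis .
qed

text \<open>
  The masses of balls of equal radius agree for the two measures, because integrating them against the
  other measure gives the same double integral.  So the comparison on open sets applies in both
  directions.
\<close>

lemma uniformly_distributed_unique: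
  fixes \<mu> \<nu> :: "'a::second_countable_topology measure" and d :: "'a \<Rightarrow> 'a \<Rightarrow> real"
  assumes "prob_space \<mu>" "prob_space \<nu>" and [simp]: "sets \<mu> = sets borel" "sets \<nu> = sets borel"
    and d[measurable]: "case_prod d \<in> borel_measurable (borel \<Otimes>\<^sub>M borel)"
    and sym: "\<And>x y. d x y = d y x"
    and small: "\<And>U x. open U \<Longrightarrow> x \<in> U \<Longrightarrow> \<exists>\<epsilon>>0. \<forall>y. d x y < \<epsilon> \<longrightarrow> y \<in> U"
    and \<mu>: "\<And>x x' \<epsilon>. \<epsilon> > 0 \<Longrightarrow> emeasure \<mu> {y. d x y < \<epsilon>} = emeasure \<mu> {y. d x' y < \<epsilon>}"
    and \<nu>: "\<And>x x' \<epsilon>. \<epsilon> > 0 \<Longrightarrow> emeasure \<nu> {y. d x y < \<epsilon>} = emeasure \<nu> {y. d x' y < \<epsilon>}"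
    and pos: "\<And>x \<epsilon>. \<epsilon> > 0 \<Longrightarrow> emeasure \<nu> {y. d x y < \<epsilon>} > 0"
  shows "\<mu> = \<nu>"
proof -
  interpret M: prob_space \<mu> by fact
  interpret N: prob_space \<nu> by fact
  interpret P: pair_sigma_finite \<mu> \<nu> by unfold_locales
  have sp: "space \<mu> = UNIV" "space \<nu> = UNIV" by (simp_all add: sets_eq_imp_space_eq[of _ borel])
  note [measurable_cong] = assms(3,4)
  have one: "emeasure \<mu> UNIV = 1" "emeasure \<nu> UNIV = 1"
    using M.emeasure_space_1 N.emeasure_space_1 by (simp_all add: sp)
  define b where "b \<epsilon> = emeasure \<nu> {y. d undefined y < \<epsilon>}" for \<epsilon>
  have b: "emeasure \<nu> {y. d x y < \<epsilon>} = b \<epsilon>" if "\<epsilon> > 0" for x \<epsilon>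
    unfolding b_def by (rule \<nu>[OF that])
  have a: "emeasure \<mu> {y. d x y < \<epsilon>} = b \<epsilon>" if "\<epsilon> > 0" for x \<epsilon>
  proof -
    note [measurable] = indicator_sublevel_measurable[OF d]
    have "b \<epsilon> = (\<integral>\<^sup>+x. emeasure \<nu> {y. d x y < \<epsilon>} \<partial>\<mu>)"
      by (simp add: b[OF that] sp one)
    also have "\<dots> = (\<integral>\<^sup>+x. \<integral>\<^sup>+y. indicator {y. d x y < \<epsilon>} y \<partial>\<nu> \<partial>\<mu>)"
      by (intro nn_integral_cong, subst nn_integral_indicator) auto
    also have "\<dots> = (\<integral>\<^sup>+y. \<integral>\<^sup>+x. indicator {y. d x y < \<epsilon>} y \<partial>\<mu> \<partial>\<nu>)"
      by (rule P.Fubini'[symmetric]) measurable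
    also have "\<dots> = (\<integral>\<^sup>+y. \<integral>\<^sup>+x. indicator {x. d y x < \<epsilon>} x \<partial>\<mu> \<partial>\<nu>)"
      by (intro nn_integral_cong) (auto simp: indicator_def sym)
    also have "\<dots> = (\<integral>\<^sup>+y. emeasure \<mu> {x. d y x < \<epsilon>} \<partial>\<nu>)"
      by (intro nn_integral_cong, subst nn_integral_indicator) auto
    also have "\<dots> = (\<integral>\<^sup>+y. emeasure \<mu> {y. d x y < \<epsilon>} \<partial>\<nu>)"
      by (intro nn_integral_cong \<mu>[OF that])
    also have "\<dots> = emeasure \<mu> {y. d x y < \<epsilon>}" by (simp add: sp one)
    finally show ?thesis ..
  qed
  have pos': "b \<epsilon> > 0" if "\<epsilon> > 0" for \<epsilon> using pos[OF that] b[OF that] by metis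
  have fin: "finite_measure \<mu>" "finite_measure \<nu>" by unfold_locales
  have "emeasure \<mu> U \<le> emeasure \<nu> U" if "open U" for U
    using fin assms(3,4) d sym small a b pos' that by (rule uniformly_distributed_le)
  moreover have "emeasure \<nu> U \<le> emeasure \<mu> U" if "open U" for U
    using fin(2,1) assms(4,3) d sym small b a pos' that by (rule uniformly_distributed_le)
  ultimately have opens: "emeasure \<mu> U = emeasure \<nu> U" if "open U" for U
    using that by (metis antisym)
  show ?thesis
  proof (rule measure_eqI_generator_eq[where E="{U. open U}" and \<Omega>=UNIV and A="\<lambda>_. UNIV"])
    show "Int_stable {U::'a set. open U}" by (auto simp: Int_stable_def)
  qed (auto simp: opens one borel_def)
qed

section \<open>The chordal distance\<close>

text \<open>
  The squared sine of the angle between the line of \<open>z\<close> and the conjugate of the row \<open>s\<close>.  Rows are used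
  as centres because the matrices in question are known to be transitive on rows; the point \<open>x\<close>
  corresponds to the row \<open>cvec (homog x)\<close>.
\<close>

definition chord :: "complex ^ 'p::finite option \<Rightarrow> complex ^ 'p \<Rightarrow> real" where
  "chord s z = 1 - (norm (scalar_product s (homog z)))\<^sup>2 / ((norm s)\<^sup>2 * (norm (homog z))\<^sup>2)"

lemma chord_smult: "k \<noteq> 0 \<Longrightarrow> chord (k *s s) z = chord s z"
  by (simp add: chord_def scalar_product_smult_left norm_mult norm_smult power_mult_distrib)

lemma chord_proj_map:
  assumes u: "unitary u" and d: "denom u z \<noteq> 0"
  shows "chord s (proj_map u z) = chord (s v* u) z"
proof -
  let ?k = "norm (denom u z)" and ?w = "homog (proj_map u z)"
  have "norm (scalar_product (s v* u) (homog z)) = ?k * norm (scalar_product s ?w)"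
    by (simp add: scalar_product_adjoint matrix_mult_homog[OF d] scalar_product_smult_right norm_mult)
  moreover have "norm (homog z) = ?k * norm ?w"
    using unitary_norm[OF u, of "homog z"] by (simp add: matrix_mult_homog[OF d] norm_smult)
  ultimately show ?thesis
    using d unfolding chord_def unitary_norm_row[OF u] by (simp add: power_mult_distrib)
qed

lemma continuous_on_cvec [continuous_intros]:
  "continuous_on A f \<Longrightarrow> continuous_on A (\<lambda>x. cvec (f x))"
  unfolding cvec_def by (intro continuous_intros) auto

lemma continuous_on_chord [continuous_intros]:
  assumes "continuous_on A s" "continuous_on A f" "\<And>x. x \<in> A \<Longrightarrow> s x \<noteq> 0"
  shows "continuous_on A (\<lambda>x. chord (s x) (f x))"
  unfolding chord_def using assms by (intro continuous_intros) auto

lemma norm_cvec [simp]: "norm (cvec x) = norm x"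
  by (simp add: norm_vec_def cvec_def)

lemma cvec_eq_0_iff [simp]: "cvec x = 0 \<longleftrightarrow> x = 0"
  by (simp add: cvec_def vec_eq_iff)

lemma norm_scalar_product_cvec_commute:
  "norm (scalar_product (cvec x) y) = norm (scalar_product (cvec y) x)"
proof -
  have "scalar_product (cvec x) y = cnj (scalar_product (cvec y) x)"
    by (simp add: scalar_product_def cvec_def mult.commute)
  then show ?thesis by simp
qed

lemma chord_commute: "chord (cvec (homog x)) y = chord (cvec (homog y)) x"
  by (simp add: chord_def norm_scalar_product_cvec_commute[of "homog x"] mult.commute)

lemma chord_self: "chord (cvec (homog x)) x = 0"
proof -
  have "norm (scalar_product (cvec (homog x)) (homog x)) = (norm (homog x))\<^sup>2"
    by (simp only: scalar_product_commute[of "cvec _"] scalar_product_cvec norm_of_real abs_power2)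
  then show ?thesis by (simp add: chord_def power2_eq_square)
qed

text \<open>
  After clearing denominators the difference of the two sides is the defect in the Cauchy-Schwarz
  inequality for \<open>x\<close> and \<open>y\<close>.
\<close>

lemma chord_lower_bound:
  "(norm (x - y))\<^sup>2 \<le> chord (cvec (homog x)) y * ((1 + (norm x)\<^sup>2) * (1 + (norm y)\<^sup>2))"
proof -
  define c where "c = scalar_product (cvec x) y"
  have sp: "scalar_product (cvec (homog x)) (homog y) = 1 + c"
    by (simp add: scalar_product_def cvec_def sum_UNIV_option c_def)
  have "x \<bullet> y = Re c"
    by (simp add: c_def scalar_product_def cvec_def inner_vec_def inner_complex_def)
  then have diff: "(norm (x - y))\<^sup>2 = (norm x)\<^sup>2 + (norm y)\<^sup>2 - 2 * Re c"
    by (simp add: power2_norm_eq_inner inner_diff inner_commute)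
  have c1: "(norm (1 + c))\<^sup>2 = 1 + 2 * Re c + (norm c)\<^sup>2"
    unfolding cmod_power2 by (simp add: power2_eq_square algebra_simps)
  have "norm c \<le> norm x * norm y" using norm_scalar_product_le[of "cvec x" y] by (simp add: c_def)
  then have "(norm c)\<^sup>2 \<le> (norm x)\<^sup>2 * (norm y)\<^sup>2"
    by (metis norm_ge_zero power_mono power_mult_distrib)
  moreover have "(1 + (norm x)\<^sup>2) * (1 + (norm y)\<^sup>2) > 0" by (intro mult_pos_pos add_pos_nonneg) auto
  then have "chord (cvec (homog x)) y * ((1 + (norm x)\<^sup>2) * (1 + (norm y)\<^sup>2)) =
      (1 + (norm x)\<^sup>2) * (1 + (norm y)\<^sup>2) - (norm (1 + c))\<^sup>2"
  proof -
    have cancel: "(1 - N / P) * P = P - N" if "P > 0" for N P :: real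
      using that by (simp add: left_diff_distrib)
    assume "(1 + (norm x)\<^sup>2) * (1 + (norm y)\<^sup>2) > 0"
    then show ?thesis by (simp only: chord_def sp norm_cvec norm_homog cancel)
  qed
  ultimately show ?thesis unfolding diff c1 by (simp add: algebra_simps)
qed

lemma chord_small:
  assumes "open U" "x \<in> U" shows "\<exists>\<epsilon>>0. \<forall>y. chord (cvec (homog x)) y < \<epsilon> \<longrightarrow> y \<in> U"
proof -
  obtain e where e: "e > 0" "ball x e \<subseteq> U" using assms open_contains_ball by blast
  define A where "A = 1 + (norm x)\<^sup>2"
  have A: "A \<ge> 1" by (simp add: A_def)
  \<comment> \<open>With \<open>D = norm (x - y) ^ 2\<close> the lower bound gives \<open>D \<le> 2 \<epsilon> A ^ 2 + 2 \<epsilon> A D\<close>.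
    The first bound on \<open>\<epsilon>\<close> absorbs the last term, the second one makes the rest small.\<close>
  define \<epsilon> where "\<epsilon> = min (1 / (4 * A)) (e\<^sup>2 / (8 * A\<^sup>2))"
  have \<epsilon>: "\<epsilon> > 0" "\<epsilon> * A \<le> 1 / 4" "\<epsilon> * A\<^sup>2 \<le> e\<^sup>2 / 8"
  proof -
    show "\<epsilon> > 0" using e A by (simp add: \<epsilon>_def)
    have "\<epsilon> * A \<le> 1 / (4 * A) * A" using A by (intro mult_right_mono) (auto simp: \<epsilon>_def)
    then show "\<epsilon> * A \<le> 1 / 4" using A by simp
    have "\<epsilon> * A\<^sup>2 \<le> e\<^sup>2 / (8 * A\<^sup>2) * A\<^sup>2" by (intro mult_right_mono) (auto simp: \<epsilon>_def)
    then show "\<epsilon> * A\<^sup>2 \<le> e\<^sup>2 / 8" using A by simp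
  qed
  have "y \<in> U" if y: "chord (cvec (homog x)) y < \<epsilon>" for y
  proof -
    let ?D = "(norm (x - y))\<^sup>2"
    have "norm y \<le> norm x + norm (x - y)" by (metis norm_minus_commute norm_triangle_sub)
    then have "(norm y)\<^sup>2 \<le> (norm x + norm (x - y))\<^sup>2" by (intro power_mono) auto
    also have "\<dots> \<le> 2 * (norm x)\<^sup>2 + 2 * ?D"
      using sum_squares_bound[of "norm x" "norm (x - y)"] by (simp add: power2_sum)
    finally have yle: "1 + (norm y)\<^sup>2 \<le> 2 * A + 2 * ?D" by (simp add: A_def)
    have "?D \<le> chord (cvec (homog x)) y * (A * (1 + (norm y)\<^sup>2))"
      unfolding A_def by (rule chord_lower_bound)
    also have "\<dots> \<le> \<epsilon> * (A * (1 + (norm y)\<^sup>2))"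
      using y A by (intro mult_right_mono) auto
    also have "\<dots> \<le> \<epsilon> * (A * (2 * A + 2 * ?D))"
      using \<epsilon>(1) A yle by (intro mult_left_mono) auto
    also have "\<dots> = 2 * (\<epsilon> * A\<^sup>2) + 2 * ((\<epsilon> * A) * ?D)" by (simp add: power2_eq_square algebra_simps)
    also have "\<dots> \<le> 2 * (e\<^sup>2 / 8) + 2 * (1 / 4 * ?D)"
      using \<epsilon> by (intro add_mono mult_left_mono mult_right_mono) auto
    finally have "?D \<le> e\<^sup>2 / 2" by simp
    also have "\<dots> < e\<^sup>2" using e(1) by simp
    finally have "norm (x - y) < e" using e(1) by (simp add: power_less_imp_less_base)
    then show ?thesis using e(2) by (auto simp: dist_norm)
  qed
  then show ?thesis using \<epsilon>(1) by blast
qed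

text \<open>
  Some unitary matrix sends the hyperplane to infinity.  If the hyperplane had mass, the image measure
  would lose it, contrary to unitary invariance.
\<close>

lemma no_hyperplane_mass_std_cauchy: "no_hyperplane_mass (std_cauchy :: (complex ^ 'p::finite) measure)"
  unfolding no_hyperplane_mass_def
proof (intro allI impI)
  fix s :: "complex ^ 'p option" assume "s \<noteq> 0"
  then obtain u :: "complex ^ 'p option ^ 'p option" and k where u: "unitary u" "k \<noteq> 0" "u $ None = k *s s"
    by (rule exists_unitary_row)
  interpret prob_space "std_cauchy :: (complex ^ 'p) measure" by (rule prob_space_std_cauchy)
  have total: "emeasure std_cauchy (UNIV :: (complex ^ 'p) set) = 1"
    using emeasure_space_1 by simp
  have eq: "{z. scalar_product s (homog z) = 0} = UNIV - {z. denom u z \<noteq> 0}"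
    by (auto simp: denom_row u(2,3) scalar_product_smult_left)
  have "emeasure std_cauchy {z. denom u z \<noteq> 0} = emeasure (act u std_cauchy) UNIV"
    by (simp add: emeasure_act)
  then have "emeasure std_cauchy {z. denom u z \<noteq> 0} = 1"
    by (simp add: act_unitary_std_cauchy[OF u(1)] total)
  moreover have "{z. denom u z \<noteq> 0} \<in> sets borel" by measurable
  ultimately show "emeasure std_cauchy {z. scalar_product s (homog z) = 0} = 0"
    unfolding eq by (subst emeasure_Diff) (auto simp: total)
qed

lemma emeasure_chord_unitary:
  fixes \<nu> :: "(complex ^ 'p::finite) measure"
  assumes \<nu>: "sets \<nu> = sets borel" "no_hyperplane_mass \<nu>" and u: "unitary u" "act u \<nu> = \<nu>" and s: "s \<noteq> 0"
  shows "emeasure \<nu> {z. chord (s v* u) z < \<epsilon>} = emeasure \<nu> {z. chord s z < \<epsilon>}"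
proof -
  note [measurable_cong] = \<nu>(1)
  have [measurable]: "(\<lambda>z. chord s z) \<in> borel_measurable borel" if "s \<noteq> 0" for s :: "complex ^ 'p option"
    using that by (intro borel_measurable_continuous_onI continuous_intros)
  note [measurable] = this[OF s] this[OF GL_row_mult_nonzero[OF unitary_GL[OF u(1)] s]]
  have "{z. denom u z = 0} \<in> null_sets \<nu>"
    using no_hyperplane_mass_denom[OF \<nu>(2) unitary_GL[OF u(1)]] by (intro null_setsI) measurable
  then have AE: "AE z in \<nu>. denom u z \<noteq> 0" by (rule AE_I') auto
  have "emeasure \<nu> {z. chord s z < \<epsilon>} = emeasure (act u \<nu>) {z. chord s z < \<epsilon>}" by (simp add: u(2))
  also have "\<dots> = emeasure \<nu> {z. denom u z \<noteq> 0 \<and> proj_map u z \<in> {z. chord s z < \<epsilon>}}"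
    by (rule emeasure_act[OF \<nu>(1)]) measurable
  also have "\<dots> = emeasure \<nu> {z. chord (s v* u) z < \<epsilon>}"
  proof (rule emeasure_eq_AE)
    show "AE z in \<nu>. (z \<in> {z. denom u z \<noteq> 0 \<and> proj_map u z \<in> {z. chord s z < \<epsilon>}}) = (z \<in> {z. chord (s v* u) z < \<epsilon>})"
      using AE by eventually_elim (simp add: chord_proj_map[OF u(1)])
  qed measurable
  finally show ?thesis ..
qed

text \<open>
  A unitary matrix that preserves \<open>\<nu>\<close> and moves the row \<open>e\<close> to a multiple of \<open>s\<close> carries chordal balls
  about \<open>s\<close> to chordal balls about \<open>e\<close>.  Hence \<open>\<nu>\<close> is uniformly distributed, as is the standard Cauchy
  distribution.
\<close>

lemma unitary_transitive_imp_std_cauchy: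
  fixes \<nu> :: "(complex ^ 'p::finite) measure"
  assumes prob: "prob_space \<nu>" and \<nu>: "sets \<nu> = sets borel" "no_hyperplane_mass \<nu>" and e: "e \<noteq> 0"
    and trans: "\<And>s. s \<noteq> 0 \<Longrightarrow> \<exists>u k. unitary u \<and> act u \<nu> = \<nu> \<and> k \<noteq> 0 \<and> e v* u = k *s s"
  shows "\<nu> = std_cauchy"
proof -
  have const: "emeasure M {z. chord s z < \<epsilon>} = emeasure M {z. chord e z < \<epsilon>}"
    if M: "sets M = sets borel" "no_hyperplane_mass M" and "s \<noteq> 0" "e \<noteq> 0"
      and ex: "\<exists>u k. unitary u \<and> act u M = M \<and> k \<noteq> 0 \<and> e v* u = k *s s"
    for M :: "(complex ^ 'p) measure" and e s \<epsilon>
  proof -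
    obtain u k where u: "unitary u" "act u M = M" and k: "k \<noteq> 0" "e v* u = k *s s" using ex by blast
    have "emeasure M {z. chord e z < \<epsilon>} = emeasure M {z. chord (k *s s) z < \<epsilon>}"
      unfolding k(2)[symmetric] by (rule emeasure_chord_unitary[OF M u \<open>e \<noteq> 0\<close>, symmetric])
    then show ?thesis by (simp add: chord_smult[OF k(1)])
  qed
  have cauchy_trans: "\<exists>u k. unitary u \<and> act u std_cauchy = std_cauchy \<and> k \<noteq> 0 \<and> axis None 1 v* u = k *s s"
    if s: "s \<noteq> 0" for s :: "complex ^ 'p option"
  proof -
    obtain u :: "complex ^ 'p option ^ 'p option" and k where "unitary u" "k \<noteq> 0" "u $ None = k *s s"
      using exists_unitary_row[OF s] .
    then show ?thesis using act_unitary_std_cauchy by (auto simp: axis_vector_matrix_mult)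
  qed
  have "continuous_on UNIV (\<lambda>q :: (complex ^ 'p) \<times> (complex ^ 'p). chord (cvec (homog (fst q))) (snd q))"
    by (intro continuous_intros) auto
  then have meas: "case_prod (\<lambda>x y :: complex ^ 'p. chord (cvec (homog x)) y) \<in> borel_measurable (borel \<Otimes>\<^sub>M borel)"
    unfolding borel_prod case_prod_unfold by (rule borel_measurable_continuous_onI)
  show ?thesis
  proof (rule uniformly_distributed_unique[where d = "\<lambda>x y. chord (cvec (homog x)) y"])
    fix x x' :: "complex ^ 'p" and \<epsilon> :: real
    have nz: "cvec (homog x) \<noteq> 0" for x :: "complex ^ 'p" by simp
    show "emeasure \<nu> {y. chord (cvec (homog x)) y < \<epsilon>} = emeasure \<nu> {y. chord (cvec (homog x')) y < \<epsilon>}"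
      using const[OF \<nu> nz e trans[OF nz]] by simp
    have ax: "axis None 1 \<noteq> (0 :: complex ^ 'p option)" by simp
    show "emeasure std_cauchy {y. chord (cvec (homog x)) y < \<epsilon>} = emeasure std_cauchy {y. chord (cvec (homog x')) y < \<epsilon>}"
      using const[OF sets_std_cauchy no_hyperplane_mass_std_cauchy nz ax cauchy_trans[OF nz]] by simp
    assume "\<epsilon> > 0"
    then have "x \<in> {y. chord (cvec (homog x)) y < \<epsilon>}" by (simp add: chord_self)
    moreover have "open {y. chord (cvec (homog x)) y < \<epsilon>}"
      by (intro open_Collect_less continuous_intros) auto
    ultimately show "0 < emeasure std_cauchy {y. chord (cvec (homog x)) y < \<epsilon>}"
      by (intro emeasure_std_cauchy_pos) auto
  qed (use prob \<nu> prob_space_std_cauchy meas chord_commute chord_small in auto)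
qed

section \<open>Compactness of the stabiliser of a measure\<close>

text \<open>
  A function of degree zero on homogeneous coordinates is a function on projective space, so invariance of
  the measure can be used without denominators.
\<close>

lemma integral_stabilizer:
  fixes f :: "complex ^ 'p::finite option \<Rightarrow> 'b::{banach, second_countable_topology}"
  assumes \<mu>: "sets \<mu> = sets borel" and n: "no_hyperplane_mass \<mu>" and h: "h \<in> GL" "act h \<mu> = \<mu>"
    and f: "\<And>k x. k \<noteq> 0 \<Longrightarrow> f (k *s x) = f x" and [measurable]: "f \<in> borel_measurable borel"
  shows "(\<integral>z. f (h *v homog z) \<partial>\<mu>) = (\<integral>z. f (homog z) \<partial>\<mu>)"
proof -
  note [measurable_cong] = \<mu>
  have null: "emeasure \<mu> {z. denom h z = 0} = 0" by (rule no_hyperplane_mass_denom[OF n h(1)])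
  then have "{z. denom h z = 0} \<in> null_sets \<mu>" by (intro null_setsI) measurable
  then have AE: "AE z in \<mu>. denom h z \<noteq> 0" by (rule AE_I') auto
  have "(\<integral>z. f (homog z) \<partial>\<mu>) = (\<integral>z. f (homog z) \<partial>distr \<mu> borel (proj_map h))"
    using act_eq_distr[OF \<mu> null] h(2) by simp
  also have "\<dots> = (\<integral>z. f (homog (proj_map h z)) \<partial>\<mu>)"
    by (rule integral_distr) measurable
  also have "\<dots> = (\<integral>z. f (h *v homog z) \<partial>\<mu>)"
  proof (rule integral_cong_AE)
    show "AE z in \<mu>. f (homog (proj_map h z)) = f (h *v homog z)"
      using AE by eventually_elim (simp add: matrix_mult_homog f)
  qed measurable
  finally show ?thesis ..
qed


lemma no_hyperplane_mass_AE:
  assumes \<mu>: "sets \<mu> = sets borel" and n: "no_hyperplane_mass \<mu>" and s: "s \<noteq> 0"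
  shows "AE z in \<mu>. scalar_product s (homog z) \<noteq> 0"
proof (rule AE_I')
  note [measurable_cong] = \<mu>
  show "{z. scalar_product s (homog z) = 0} \<in> null_sets \<mu>"
    using n s by (intro null_setsI) (simp add: no_hyperplane_mass_def, measurable)
qed auto

text \<open>
  Otherwise a sequence \<open>h k / norm (h k)\<close> converges to a nonzero singular matrix \<open>T'\<close>, along a
  subsequence.  Choose a row \<open>s \<noteq> 0\<close> with \<open>s T' = 0\<close>.  The integral of \<open>norm (s x) / norm x\<close> is unchanged
  under every \<open>h k\<close>, whereas the integrand along the sequence tends to 0 off the kernel of \<open>T'\<close>, which
  is contained in a hyperplane.  So the integral vanishes and the hyperplane \<open>s x = 0\<close> has full mass.
\<close>

lemma stabilizer_det_bound:
  fixes \<mu> :: "(complex ^ 'p::finite) measure"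
  assumes "prob_space \<mu>" and \<mu>: "sets \<mu> = sets borel" and n: "no_hyperplane_mass \<mu>"
  shows "\<exists>\<delta>>0. \<forall>h\<in>GL. act h \<mu> = \<mu> \<longrightarrow> \<delta> * norm h ^ CARD('p option) \<le> norm (det h)"
proof (rule ccontr)
  interpret prob_space \<mu> by fact
  note [measurable_cong] = \<mu>
  let ?n = "CARD('p option)"
  assume *: "\<not> ?thesis"
  have "\<exists>h\<in>GL. act h \<mu> = \<mu> \<and> norm (det h) < 1 / (real k + 1) * norm h ^ ?n" for k :: nat
    using * by (auto simp: not_le dest!: spec[of _ "1 / (real k + 1)"])
  then obtain h where h: "\<And>k. h k \<in> GL" "\<And>k. act (h k) \<mu> = \<mu>"
    and det: "\<And>k :: nat. norm (det (h k)) < 1 / (real k + 1) * norm (h k) ^ ?n" by metis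
  define T where "T k = (1 / norm (h k)) *\<^sub>R h k" for k
  have h0: "norm (h k) > 0" for k using GL_row_nonzero[OF h(1)[of k], of None] by auto
  have T_sphere: "T k \<in> sphere 0 1" for k using h0[of k] by (simp add: T_def)
  have det_T: "norm (det (T k)) < 1 / (real k + 1)" for k
    using det[of k] h0[of k] by (simp add: T_def det_scaleR norm_mult norm_power norm_divide field_simps)
  obtain T' r where T': "T' \<in> sphere 0 1" and r: "strict_mono r" "(T \<circ> r) \<longlonglongrightarrow> T'"
    using compact_sphere[of "0 :: complex ^ 'p option ^ 'p option" 1] T_sphere unfolding compact_def by blast
  have "(\<lambda>k. det (T k)) \<longlonglongrightarrow> 0"
  proof (rule Lim_null_comparison)
    show "\<forall>\<^sub>F k in sequentially. norm (det (T k)) \<le> 1 / (real k + 1)"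
      using det_T by (auto intro: less_imp_le always_eventually)
    show "(\<lambda>k. 1 / (real k + 1)) \<longlonglongrightarrow> 0" by real_asymp
  qed
  from LIMSEQ_subseq_LIMSEQ[OF this r(1)] tendsto_det[OF r(2)] have "det T' = 0"
    by (auto simp: o_def intro: LIMSEQ_unique)
  then obtain s where s: "s \<noteq> 0" "s v* T' = 0" by (rule det_zero_left_kernel)
  define \<phi> where "\<phi> x = norm (scalar_product s x) / norm x" for x
  have \<phi>_scale: "\<phi> (k *s x) = \<phi> x" if "k \<noteq> 0" for k x
    using that by (simp add: \<phi>_def scalar_product_smult_right norm_mult norm_smult)
  have [measurable]: "\<phi> \<in> borel_measurable borel" unfolding \<phi>_def by measurable
  have \<phi>_bound: "\<bar>\<phi> x\<bar> \<le> norm s" for x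
    using norm_scalar_product_le[of s x] by (cases "x = 0") (simp_all add: \<phi>_def divide_le_eq)
  define m where "m = (\<integral>z. \<phi> (homog z) \<partial>\<mu>)"
  have m: "(\<integral>z. \<phi> (T k *v homog z) \<partial>\<mu>) = m" for k
  proof -
    have "T k *v x = of_real (1 / norm (h k)) *s (h k *v x)" for x
      by (simp add: T_def vec_eq_iff matrix_vector_mult_def scaleR_conv_of_real[where 'a=complex] sum_distrib_left mult.assoc sum_divide_distrib)
    then have "\<phi> (T k *v x) = \<phi> (h k *v x)" for x
      using \<phi>_scale[of "of_real (1 / norm (h k))" "h k *v x"] h0[of k] by simp
    then show ?thesis
      unfolding m_def using integral_stabilizer[OF \<mu> n h(1,2), of \<phi> k] \<phi>_scale by simp
  qed
  obtain i where i: "T' $ i \<noteq> 0" using T' by (metis mem_sphere_0 norm_zero vec_eq_iff zero_index zero_neq_one)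
  have "(\<lambda>k. \<integral>z. \<phi> (T (r k) *v homog z) \<partial>\<mu>) \<longlonglongrightarrow> (\<integral>z. 0 \<partial>\<mu>)"
  proof (rule integral_dominated_convergence)
    show "AE z in \<mu>. (\<lambda>k. \<phi> (T (r k) *v homog z)) \<longlonglongrightarrow> 0"
      using no_hyperplane_mass_AE[OF \<mu> n i]
    proof eventually_elim
      case (elim z)
      have T'z: "T' *v homog z \<noteq> 0" using elim by (metis matrix_vector_nth zero_index)
      have "isCont (\<lambda>x. norm (scalar_product s x) / norm x) (T' *v homog z)"
      proof -
        have "continuous_on (- {0}) (\<lambda>x. norm (scalar_product s x) / norm x)"
          by (intro continuous_intros) auto
        then show ?thesis using T'z by (subst (asm) continuous_on_eq_continuous_at) auto
      qed
      moreover have "(\<lambda>k. T (r k) *v homog z) \<longlonglongrightarrow> T' *v homog z"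
        unfolding matrix_vector_mult_def using r(2) by (intro tendsto_intros) (simp add: o_def)
      ultimately have "(\<lambda>k. \<phi> (T (r k) *v homog z)) \<longlonglongrightarrow> \<phi> (T' *v homog z)"
        unfolding \<phi>_def by (rule isCont_tendsto_compose)
      moreover have "\<phi> (T' *v homog z) = 0"
        by (simp add: \<phi>_def scalar_product_adjoint[symmetric] s(2)) (simp add: scalar_product_def)
      ultimately show ?case by simp
    qed
    show "integrable \<mu> (\<lambda>_. norm s)" by simp
    show "AE z in \<mu>. norm (\<phi> (T (r k) *v homog z)) \<le> norm s" for k using \<phi>_bound by simp
  qed measurable
  then have "m = 0" by (simp add: m LIMSEQ_const_iff)
  moreover have "integrable \<mu> (\<lambda>z. \<phi> (homog z))"
    by (rule integrable_const_bound[of _ "norm s"]) (use \<phi>_bound in auto)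
  ultimately have "AE z in \<mu>. \<phi> (homog z) = 0"
    unfolding m_def by (subst (asm) integral_nonneg_eq_0_iff_AE) (auto simp: \<phi>_def)
  with no_hyperplane_mass_AE[OF \<mu> n s(1)] have "AE z in \<mu>. False"
    by eventually_elim (simp add: \<phi>_def)
  then show False by simp
qed


text \<open>
  Scalar matrices act trivially, so the stabiliser itself is never bounded; the determinant fixes the scale.
\<close>

definition unimodular_stabilizer :: "(complex ^ 'p::finite) measure \<Rightarrow> (complex ^ 'p option ^ 'p option) set" where
  "unimodular_stabilizer \<mu> = {h \<in> GL. act h \<mu> = \<mu> \<and> norm (det h) = 1}"

lemma unimodular_stabilizer_bounded:
  fixes \<mu> :: "(complex ^ 'p::finite) measure"
  assumes "prob_space \<mu>" and \<mu>: "sets \<mu> = sets borel" and n: "no_hyperplane_mass \<mu>"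
  obtains C where "\<And>h. h \<in> unimodular_stabilizer \<mu> \<Longrightarrow> norm h \<le> C"
proof -
  let ?n = "CARD('p option)"
  obtain \<delta> where \<delta>: "\<delta> > 0" "\<And>h. h \<in> GL \<Longrightarrow> act h \<mu> = \<mu> \<Longrightarrow> \<delta> * norm h ^ ?n \<le> norm (det h)"
    using stabilizer_det_bound[OF assms] by blast
  have "norm h \<le> max 1 (1 / \<delta>)" if "h \<in> unimodular_stabilizer \<mu>" for h
  proof (cases "norm h \<le> 1")
    case False
    have "norm h \<le> norm h ^ ?n" using False by (intro self_le_power) auto
    also have "\<dots> \<le> 1 / \<delta>"
      using \<delta>(2)[of h] that \<delta>(1) by (simp add: unimodular_stabilizer_def field_simps)
    finally show ?thesis by simp
  qed simp
  then show ?thesis using that by blast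
qed

lemma unimodular_stabilizer_mult:
  assumes \<mu>: "sets \<mu> = sets borel" and n: "no_hyperplane_mass \<mu>"
    and "g \<in> unimodular_stabilizer \<mu>" "h \<in> unimodular_stabilizer \<mu>"
  shows "g ** h \<in> unimodular_stabilizer \<mu>"
  using assms(3,4) act_mult[OF \<mu> no_hyperplane_mass_denom[OF n], of h g]
  by (auto simp: unimodular_stabilizer_def GL_mult det_mul norm_mult)

lemma act_inverse:
  assumes \<mu>: "sets \<mu> = sets borel" and null: "emeasure \<mu> {z. denom h z = 0} = 0" and "h' ** h = mat 1"
  shows "act h' (act h \<mu>) = \<mu>"
  using act_mult[OF \<mu> null, of h'] act_one[OF \<mu>] assms(3) by simp

lemma unimodular_stabilizer_inverse:
  assumes \<mu>: "sets \<mu> = sets borel" and n: "no_hyperplane_mass \<mu>" and h: "h \<in> unimodular_stabilizer \<mu>"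
  obtains h' where "h' \<in> unimodular_stabilizer \<mu>" "h' ** h = mat 1"
proof -
  have hGL: "h \<in> GL" and act: "act h \<mu> = \<mu>" and d: "norm (det h) = 1"
    using h by (auto simp: unimodular_stabilizer_def)
  obtain h' where h': "h' \<in> GL" "h' ** h = mat 1" using GL_inverse[OF hGL] by metis
  have "det h' * det h = 1" using h'(2) det_mul[of h' h] by simp
  then have "norm (det h') = 1" using d by (metis mult.right_neutral norm_mult norm_one)
  moreover have "act h' \<mu> = \<mu>"
    using act_inverse[OF \<mu> no_hyperplane_mass_denom[OF n hGL] h'(2)] act by simp
  ultimately show ?thesis using that h' by (auto simp: unimodular_stabilizer_def)
qed

section \<open>An invariant Hermitian form\<close>

definition orbit_norm :: "(complex ^ 'p::finite) measure \<Rightarrow> complex ^ 'p option \<Rightarrow> real" where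
  "orbit_norm \<mu> x = (SUP h\<in>unimodular_stabilizer \<mu>. norm (h *v x))"

lemma measurable_cnj [measurable (raw)]:
  assumes "f \<in> borel_measurable M" shows "(\<lambda>z. cnj (f z)) \<in> borel_measurable M"
proof -
  have "cnj \<in> borel_measurable borel" by (intro borel_measurable_continuous_onI continuous_intros)
  from measurable_compose[OF assms this] show ?thesis .
qed

context
  fixes \<mu> :: "(complex ^ 'p::finite) measure"
  assumes prob: "prob_space \<mu>" and sets_\<mu>: "sets \<mu> = sets borel" and generic: "no_hyperplane_mass \<mu>"
begin

lemma one_stabilizes: "mat 1 \<in> unimodular_stabilizer \<mu>"
  using act_one[OF sets_\<mu>] by (simp add: unimodular_stabilizer_def GL_def invertible_det_nz)

lemma orbit_bdd: "bdd_above ((\<lambda>h. norm (h *v x)) ` unimodular_stabilizer \<mu>)"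
proof -
  obtain C where C: "\<And>h. h \<in> unimodular_stabilizer \<mu> \<Longrightarrow> norm h \<le> C"
    using unimodular_stabilizer_bounded[OF prob sets_\<mu> generic] by blast
  show ?thesis
    by (rule bdd_aboveI2[of _ _ "C * norm x"])
       (meson C mult_right_mono norm_ge_zero norm_matrix_vector_le order_trans)
qed

lemma orbit_norm_ge: "h \<in> unimodular_stabilizer \<mu> \<Longrightarrow> norm (h *v x) \<le> orbit_norm \<mu> x"
  unfolding orbit_norm_def by (rule cSUP_upper[OF _ orbit_bdd])

lemma norm_le_orbit_norm: "norm x \<le> orbit_norm \<mu> x"
  using orbit_norm_ge[OF one_stabilizes, of x] by simp

lemma orbit_norm_le: "(\<And>h. h \<in> unimodular_stabilizer \<mu> \<Longrightarrow> norm (h *v x) \<le> B) \<Longrightarrow> orbit_norm \<mu> x \<le> B"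
  unfolding orbit_norm_def using one_stabilizes by (intro cSUP_least) auto

lemma orbit_norm_invariant:
  assumes h: "h \<in> unimodular_stabilizer \<mu>" shows "orbit_norm \<mu> (h *v x) = orbit_norm \<mu> x"
proof -
  have le: "orbit_norm \<mu> (h *v x) \<le> orbit_norm \<mu> x" if "h \<in> unimodular_stabilizer \<mu>" for h x
  proof (rule orbit_norm_le)
    fix k assume "k \<in> unimodular_stabilizer \<mu>"
    then show "norm (k *v (h *v x)) \<le> orbit_norm \<mu> x"
      using unimodular_stabilizer_mult[OF sets_\<mu> generic _ that] orbit_norm_ge
      by (simp add: matrix_vector_mul_assoc)
  qed
  obtain h' where h': "h' \<in> unimodular_stabilizer \<mu>" "h' ** h = mat 1"
    using unimodular_stabilizer_inverse[OF sets_\<mu> generic h] .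
  have "orbit_norm \<mu> x = orbit_norm \<mu> (h' *v (h *v x))" by (simp add: matrix_vector_mul_assoc h'(2))
  with le[OF h'(1), of "h *v x"] le[OF h, of x] show ?thesis by simp
qed

lemma orbit_norm_scale: "orbit_norm \<mu> (k *s x) = norm k * orbit_norm \<mu> x"
proof -
  have le: "orbit_norm \<mu> (k *s x) \<le> norm k * orbit_norm \<mu> x" for k x
    by (rule orbit_norm_le) (simp add: vec.scale norm_smult mult_left_mono orbit_norm_ge)
  show ?thesis
  proof (cases "k = 0")
    case True
    have "orbit_norm \<mu> 0 = 0" 
      using orbit_norm_le[of 0 0] norm_le_orbit_norm[of 0] by simp
    then show ?thesis using True by simp
  next
    case False
    then have "norm k * orbit_norm \<mu> x \<le> orbit_norm \<mu> (k *s x)"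
      using le[of "1/k" "k *s x"] by (simp add: vector_smult_assoc norm_divide field_simps)
    with le[of k x] show ?thesis by simp
  qed
qed

lemma measurable_orbit_norm [measurable]: "orbit_norm \<mu> \<in> borel_measurable borel"
proof (subst borel_measurable_iff_greater, intro allI)
  fix a
  \<comment> \<open>a supremum of continuous functions is lower semicontinuous\<close>
  have "{x. a < orbit_norm \<mu> x} = (\<Union>h\<in>unimodular_stabilizer \<mu>. {x. a < norm (h *v x)})"
  proof -
    have "unimodular_stabilizer \<mu> \<noteq> {}" using one_stabilizes by blast
    then show ?thesis by (auto simp: orbit_norm_def less_cSUP_iff[OF _ orbit_bdd])
  qed
  moreover have "open \<dots>" by (intro open_UN ballI open_Collect_less continuous_intros)
  ultimately show "{x \<in> space borel. a < orbit_norm \<mu> x} \<in> sets borel" by simp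
qed


text \<open>
  Dividing by the invariant norm makes the integrand a bounded function of degree zero.  It transforms
  under an element \<open>h\<close> of the unimodular stabiliser by replacing the rows \<open>r\<close> and \<open>s\<close> by \<open>r h\<close>
  and \<open>s h\<close>, so invariance of \<open>\<mu>\<close> becomes invariance of the form.
\<close>

definition row_form :: "complex ^ 'p option \<Rightarrow> complex ^ 'p option \<Rightarrow> complex" where
  "row_form r s = (\<integral>z. scalar_product r (homog z) * cnj (scalar_product s (homog z)) / of_real ((orbit_norm \<mu> (homog z))\<^sup>2) \<partial>\<mu>)"

lemma integrable_row_form:
  "integrable \<mu> (\<lambda>z. scalar_product r (homog z) * cnj (scalar_product s (homog z)) / of_real ((orbit_norm \<mu> (homog z))\<^sup>2))"
proof -
  interpret prob_space \<mu> by (rule prob)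
  note [measurable_cong] = sets_\<mu>
  show ?thesis
  proof (rule integrable_const_bound[of _ "norm r * norm s"])
    show "AE z in \<mu>. norm (scalar_product r (homog (z :: complex ^ 'p)) * cnj (scalar_product s (homog z)) / of_real ((orbit_norm \<mu> (homog z))\<^sup>2)) \<le> norm r * norm s"
    proof (rule AE_I2)
      fix z :: "complex ^ 'p"
      have "norm (homog z) > 0" by simp
      then have pos: "orbit_norm \<mu> (homog z) > 0" using norm_le_orbit_norm[of "homog z"] by linarith
      have "norm (scalar_product r (homog z)) * norm (scalar_product s (homog z)) \<le>
         (norm r * orbit_norm \<mu> (homog z)) * (norm s * orbit_norm \<mu> (homog z))"
        using norm_le_orbit_norm[of "homog z"] pos
        by (intro mult_mono order_trans[OF norm_scalar_product_le] mult_left_mono) auto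
      then show "norm (scalar_product r (homog z) * cnj (scalar_product s (homog z)) / of_real ((orbit_norm \<mu> (homog z))\<^sup>2)) \<le> norm r * norm s"
        using pos by (simp add: norm_mult norm_divide divide_le_eq power2_eq_square mult_ac)
    qed
  qed measurable
qed

lemma row_form_add: "row_form (r + r') s = row_form r s + row_form r' s"
  unfolding row_form_def
  by (subst Bochner_Integration.integral_add[symmetric, OF integrable_row_form integrable_row_form])
     (simp add: scalar_product_def algebra_simps add_divide_distrib sum.distrib)

lemma row_form_smult: "row_form (k *s r) s = k * row_form r s"
  unfolding row_form_def
  by (subst integral_mult_right_zero[symmetric]) (simp add: scalar_product_smult_left mult.assoc)

lemma row_form_cnj: "cnj (row_form r s) = row_form s r"
proof -
  have "row_form s r = (\<integral>z. cnj (scalar_product r (homog z) * cnj (scalar_product s (homog z)) / of_real ((orbit_norm \<mu> (homog z))\<^sup>2)) \<partial>\<mu>)"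
    by (simp add: row_form_def mult.commute)
  then show ?thesis unfolding row_form_def by (simp only: Bochner_Integration.integral_cnj)
qed

text \<open>
  If \<open>row_form r r\<close> were zero, then \<open>\<mu>\<close> would be concentrated on the hyperplane \<open>r x = 0\<close>.
\<close>

lemma row_form_pos:
  assumes "r \<noteq> 0" shows "Re (row_form r r) > 0"
proof -
  interpret prob_space \<mu> by (rule prob)
  let ?f = "\<lambda>z. (norm (scalar_product r (homog z)))\<^sup>2 / (orbit_norm \<mu> (homog z))\<^sup>2"
  have eq: "scalar_product r (homog z) * cnj (scalar_product r (homog z)) / of_real ((orbit_norm \<mu> (homog z))\<^sup>2) = complex_of_real (?f z)" for z
    by (simp only: complex_norm_square[symmetric] of_real_divide)
  have "integrable \<mu> (\<lambda>z. complex_of_real (?f z))" using integrable_row_form[of r r] by (simp only: eq)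
  then have int: "integrable \<mu> ?f" using complex_of_real_integrable_eq[of \<mu> ?f] by blast
  have "row_form r r = complex_of_real (\<integral>z. ?f z \<partial>\<mu>)" unfolding row_form_def eq by (rule integral_of_real[OF int])
  moreover have "(\<integral>z. ?f z \<partial>\<mu>) \<ge> 0" by simp
  moreover have "(\<integral>z. ?f z \<partial>\<mu>) \<noteq> 0"
  proof
    assume "(\<integral>z. ?f z \<partial>\<mu>) = 0"
    then have "AE z in \<mu>. ?f z = 0" using int by (subst (asm) integral_nonneg_eq_0_iff_AE) auto
    with no_hyperplane_mass_AE[OF sets_\<mu> generic assms] have "AE z in \<mu>. False"
    proof eventually_elim
      case (elim z)
      then have "orbit_norm \<mu> (homog z) = 0" by auto
      with norm_le_orbit_norm[of "homog z"] show False by simp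
    qed
    then show False by simp
  qed
  ultimately have "(\<integral>z. ?f z \<partial>\<mu>) > 0" by linarith
  with \<open>row_form r r = _\<close> show ?thesis by simp
qed

lemma row_form_invariant:
  assumes h: "h \<in> unimodular_stabilizer \<mu>"
  shows "row_form (r v* h) (s v* h) = row_form r s"
proof -
  define F where "F x = scalar_product r x * cnj (scalar_product s x) / of_real ((orbit_norm \<mu> x)\<^sup>2)" for x
  have F_scale: "F (k *s x) = F x" if "k \<noteq> 0" for k x
  proof -
    have "k * cnj k = of_real ((norm k)\<^sup>2)" by (rule complex_norm_square[symmetric])
    then have "F (k *s x) = (of_real ((norm k)\<^sup>2) * (scalar_product r x * cnj (scalar_product s x))) / (of_real ((norm k)\<^sup>2) * of_real ((orbit_norm \<mu> x)\<^sup>2))"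
      unfolding F_def scalar_product_smult_right orbit_norm_scale power_mult_distrib of_real_mult complex_cnj_mult
      by (metis (no_types, lifting) mult.assoc mult.left_commute)
    also have "\<dots> = F x" using that unfolding F_def by (subst mult_divide_mult_cancel_left) auto
    finally show ?thesis .
  qed
  have hG: "h \<in> GL" "act h \<mu> = \<mu>" using h by (auto simp: unimodular_stabilizer_def)
  have "F \<in> borel_measurable borel" unfolding F_def by measurable
  then have "(\<integral>z. F (h *v homog z) \<partial>\<mu>) = (\<integral>z. F (homog z) \<partial>\<mu>)"
    using F_scale by (intro integral_stabilizer[OF sets_\<mu> generic hG])
  then show ?thesis
    by (simp add: row_form_def F_def scalar_product_adjoint orbit_norm_invariant[OF h])
qed

end

text \<open>
  The rows of \<open>g\<close> are an orthonormal basis for the invariant Hermitian form.  As \<open>h\<close> preserves the form,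
  the rows of \<open>g ** h\<close> are again orthonormal, and \<open>u\<close> is the transition matrix between the two bases.
\<close>

lemma unitarizable:
  fixes \<mu> :: "(complex ^ 'p::finite) measure"
  assumes "prob_space \<mu>" "sets \<mu> = sets borel" "no_hyperplane_mass \<mu>"
  obtains g where "g \<in> GL" "\<And>h u. h \<in> unimodular_stabilizer \<mu> \<Longrightarrow> u ** g = g ** h \<Longrightarrow> unitary u"
proof -
  note form = row_form_add[OF assms] row_form_smult[OF assms] row_form_cnj[OF assms] row_form_pos[OF assms]
    row_form_invariant[OF assms]
  define S where "S = row_form \<mu>"
  note form = form[folded S_def]
  have "axis None 1 \<noteq> (0 :: complex ^ 'p option)" by simp
  then obtain v :: "'p option \<Rightarrow> complex ^ 'p option" where v: "\<And>i j. S (v i) (v j) = (if i = j then 1 else 0)"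
    using hermitian_form_orthonormal_basis[of S, OF form(1) form(2) form(3) form(4), of _ None] by blast
  define g :: "complex ^ 'p option ^ 'p option" where "g = (\<chi> i. v i)"
  have g_nth: "g $ i = v i" for i by (simp add: g_def)
  have smult2: "S r (k *s s) = cnj k * S r s" for k r s by (metis form(2,3) complex_cnj_mult)
  have add2: "S r (s + s') = S r s + S r s'" for r s s' by (metis form(1,3) complex_cnj_add)
  have zero: "S 0 s = 0" for s using form(2)[of 0 0 s] by simp
  have zero2: "S s 0 = 0" for s using smult2[of s 0 0] by simp
  have sum: "S (\<Sum>j\<in>A. f j) s = (\<Sum>j\<in>A. S (f j) s)" if "finite A" for A :: "'p option set" and f s
    using that by (induction A rule: finite_induct) (simp_all add: zero form)
  have sum2: "S s (\<Sum>j\<in>A. f j) = (\<Sum>j\<in>A. S s (f j))" if "finite A" for A :: "'p option set" and f s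
    using that by (induction A rule: finite_induct) (simp_all add: zero2 add2)
  have expand: "x v* g = (\<Sum>k\<in>UNIV. x $ k *s v k)" for x
    by (simp add: vector_matrix_mult_def vec_eq_iff g_def sum_component)
  have S_g: "S (x v* g) (y v* g) = scalar_product x (cvec y)" for x y
  proof -
    have "S (x v* g) (y v* g) = (\<Sum>j\<in>UNIV. x $ j * S (v j) (y v* g))"
      unfolding expand[of x] by (simp only: sum finite form(2))
    also have "\<dots> = (\<Sum>j\<in>UNIV. x $ j * (\<Sum>k\<in>UNIV. cnj (y $ k) * (if j = k then 1 else 0)))"
      unfolding expand[of y] by (simp only: sum2 finite smult2 v)
    finally show ?thesis by (simp add: scalar_product_def cvec_def if_distrib cong: if_cong)
  qed
  have "g \<in> GL"
  proof (rule GL_left_kernel)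
    fix s assume "s v* g = 0"
    then have "scalar_product s (cvec (axis i 1)) = 0" for i using S_g[of s "axis i 1"] by (simp add: zero)
    moreover have "scalar_product s (cvec (axis i 1)) = s $ i" for i
      by (simp add: scalar_product_def cvec_def axis_def if_distrib cong: if_cong)
    ultimately show "s = 0" by (simp add: vec_eq_iff)
  qed
  moreover have "unitary u" if h: "h \<in> unimodular_stabilizer \<mu>" and u: "u ** g = g ** h" for h u
  proof -
    have "scalar_product (u $ i) (cvec (u $ j)) = (if i = j then 1 else 0)" for i j
      unfolding S_g[symmetric] matrix_row_mult[symmetric] u
      by (simp add: matrix_row_mult form(5)[OF h] g_nth v)
    then show ?thesis
      by (simp add: unitary_def vec_eq_iff matrix_matrix_mult_def adjoint_matrix_def mat_def scalar_product_def cvec_def)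
  qed
  ultimately show ?thesis using that by blast
qed


section \<open>Closure under projective maps characterises the Cauchy family\<close>

text \<open>
  If \<open>u\<close> is a unitary matrix whose last row is proportional to that of \<open>g\<close>, then \<open>g\<close> times the inverse of
  \<open>u\<close> is affine.
\<close>

lemma act_GL_std_cauchy:
  fixes g :: "complex ^ 'p::finite option ^ 'p option"
  assumes g: "g \<in> GL" obtains a where "a \<in> Aff" "act g std_cauchy = act a std_cauchy"
proof -
  obtain u :: "complex ^ 'p option ^ 'p option" and k where u: "unitary u" "k \<noteq> 0" "u $ None = k *s (g $ None)"
    using exists_unitary_row[OF GL_row_nonzero[OF g]] .
  obtain u' where u': "u' \<in> GL" "u ** u' = mat 1" "u' ** u = mat 1" using GL_inverse[OF unitary_GL[OF u(1)]] .
  have "k *s ((g ** u') $ None) = axis None 1"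
  proof -
    have "k *s ((g ** u') $ None) = (u ** u') $ None"
      by (simp add: matrix_row_mult u(3) scalar_vector_matrix_assoc)
    then show ?thesis by (simp add: u'(2) mat_def axis_def vec_eq_iff)
  qed
  then have "(1 / k) *s (k *s ((g ** u') $ None)) = (1 / k) *s axis None 1" by (rule arg_cong)
  then have "(g ** u') $ None = (1 / k) *s axis None 1"
    using u(2) by (simp add: vector_smult_assoc del: vector_mul_lcancel)
  then have "g ** u' \<in> Aff" using GL_mult[OF g u'(1)] by (auto simp: Aff_iff)
  moreover have "act g std_cauchy = act (g ** u') std_cauchy"
  proof -
    have "act (g ** u') (act u std_cauchy) = act (g ** u' ** u) std_cauchy"
      by (rule act_mult) (auto intro: no_hyperplane_mass_denom no_hyperplane_mass_std_cauchy unitary_GL u(1))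
    also have "g ** u' ** u = g" by (simp add: matrix_mul_assoc[symmetric] u'(3))
    finally show ?thesis by (simp add: act_unitary_std_cauchy[OF u(1)])
  qed
  ultimately show ?thesis using that by blast
qed

lemma act_scaleR:
  assumes "c \<noteq> 0" shows "act (c *\<^sub>R g) \<mu> = act g \<mu>"
proof -
  have "(c *\<^sub>R g) *v x = of_real c *s (g *v x)" for x
    by (simp add: vec_eq_iff matrix_vector_mult_def scaleR_conv_of_real[where 'a=complex] sum_distrib_left mult.assoc)
  then have mult: "(c *\<^sub>R g) *v homog z = of_real c *s (g *v homog z)" for z .
  then have d: "denom (c *\<^sub>R g) z = of_real c * denom g z" for z by (simp add: denom_homog)
  have "proj_map (c *\<^sub>R g) z = proj_map g z" for z
  proof (cases "denom g z = 0")
    case True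
    then show ?thesis using d[of z] by (simp add: proj_map_def)
  next
    case False
    then have nz: "denom (c *\<^sub>R g) z \<noteq> 0" using assms d by simp
    show ?thesis
      using mult[of z] nz smult_homog_eq_iff[of 1 "proj_map (c *\<^sub>R g) z" 1 "proj_map g z"]
      by (simp add: matrix_mult_homog[OF False] matrix_mult_homog[OF nz] vector_smult_assoc smult_homog_eq_iff d)
  qed
  then have "proj_map (c *\<^sub>R g) = proj_map g" by (simp add: fun_eq_iff)
  moreover have "{z. denom (c *\<^sub>R g) z \<noteq> 0} = {z. denom g z \<noteq> 0}" using assms d by simp
  ultimately show ?thesis by (simp add: act_def)
qed

lemma stabilizer_normalise:
  fixes h :: "complex ^ 'p::finite option ^ 'p option"
  assumes h: "h \<in> GL" "act h \<mu> = \<mu>"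
  obtains c where "c > 0" "c *\<^sub>R h \<in> unimodular_stabilizer \<mu>"
proof -
  let ?n = "CARD('p option)"
  have det: "norm (det h) > 0" using h(1) by (simp add: GL_def invertible_det_nz)
  define c where "c = 1 / root ?n (norm (det h))"
  have c: "c > 0" using det by (simp add: c_def)
  have "c ^ ?n * norm (det h) = 1"
  proof -
    have "root ?n (norm (det h)) ^ ?n = norm (det h)" using det by (intro real_root_pow_pos2) auto
    then show ?thesis using det unfolding c_def power_divide by simp
  qed
  then have n: "norm (det (c *\<^sub>R h)) = 1" using c by (simp add: det_scaleR norm_mult norm_power)
  then have "c *\<^sub>R h \<in> GL" unfolding GL_def mem_Collect_eq invertible_det_nz by (metis norm_zero zero_neq_one)
  then have "c *\<^sub>R h \<in> unimodular_stabilizer \<mu>"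
    using n act_scaleR[of c h \<mu>] h(2) c by (simp add: unimodular_stabilizer_def)
  then show ?thesis using that c by blast
qed

text \<open>
  If \<open>g\<close> has last row \<open>s\<close> and \<open>g \<cdot> \<mu> = a \<cdot> \<mu>\<close> with \<open>a\<close> affine, then the inverse of \<open>a\<close> times \<open>g\<close>
  stabilises \<open>\<mu>\<close> and still has last row proportional to \<open>s\<close>.
\<close>

lemma stabilizer_transitive:
  fixes \<mu> :: "(complex ^ 'p::finite) measure"
  assumes \<mu>: "sets \<mu> = sets borel" "no_hyperplane_mass \<mu>"
    and closed: "\<forall>g\<in>GL. \<exists>a\<in>Aff. act g \<mu> = act a \<mu>" and s: "s \<noteq> 0"
  obtains h k where "h \<in> unimodular_stabilizer \<mu>" "k \<noteq> 0" "h $ None = k *s s"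
proof -
  obtain g :: "complex ^ 'p option ^ 'p option" and k where g: "unitary g" "k \<noteq> 0" "g $ None = k *s s"
    using exists_unitary_row[OF s] .
  have gGL: "g \<in> GL" by (rule unitary_GL[OF g(1)])
  obtain a where a: "a \<in> Aff" "act g \<mu> = act a \<mu>" using closed gGL by blast
  obtain b where b: "b \<in> Aff" "b ** a = mat 1" using Aff_inverse[OF a(1)] by metis
  obtain l where l: "l \<noteq> 0" "b $ None = l *s axis None 1" using AffE[OF b(1)] by metis
  have "act (b ** g) \<mu> = act b (act g \<mu>)"
    by (rule act_mult[OF \<mu>(1) no_hyperplane_mass_denom[OF \<mu>(2) gGL], symmetric])
  also have "\<dots> = \<mu>"
    unfolding a(2) by (rule act_inverse[OF \<mu>(1) no_hyperplane_mass_denom[OF \<mu>(2) Aff_GL[OF a(1)]] b(2)])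
  finally obtain c where c: "c > 0" "c *\<^sub>R (b ** g) \<in> unimodular_stabilizer \<mu>"
    using stabilizer_normalise[OF GL_mult[OF Aff_GL[OF b(1)] gGL]] by blast
  have "(b ** g) $ None = (l * k) *s s"
    by (simp add: matrix_row_mult l(2) scalar_vector_matrix_assoc axis_vector_matrix_mult g(3) vector_smult_assoc)
  then have "(c *\<^sub>R (b ** g)) $ None = (of_real c * (l * k)) *s s"
    by (simp add: vec_eq_iff scaleR_conv_of_real[where 'a=complex] mult.assoc)
  moreover have "of_real c * (l * k) \<noteq> 0" using c(1) l(1) g(2) by simp
  ultimately show ?thesis using that c(2) by blast
qed

lemma closed_imp_cauchy:
  fixes \<mu> :: "(complex ^ 'p::finite) measure"
  assumes prob: "prob_space \<mu>" and \<mu>: "sets \<mu> = sets borel" "no_hyperplane_mass \<mu>"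
    and closed: "\<forall>g\<in>GL. \<exists>a\<in>Aff. act g \<mu> = act a \<mu>"
  shows "is_cauchy \<mu>"
proof -
  obtain g where g: "g \<in> GL" and unitary: "\<And>h u. h \<in> unimodular_stabilizer \<mu> \<Longrightarrow> u ** g = g ** h \<Longrightarrow> unitary u"
    using unitarizable[OF prob \<mu>] by blast
  obtain g' where g': "g' \<in> GL" "g ** g' = mat 1" "g' ** g = mat 1" using GL_inverse[OF g] .
  note null = no_hyperplane_mass_denom[OF \<mu>(2)]
  have "act g \<mu> = std_cauchy"
  proof (rule unitary_transitive_imp_std_cauchy)
    show "prob_space (act g \<mu>)" by (rule prob_space_act[OF \<mu> g prob])
    show "sets (act g \<mu>) = sets borel" by simp
    show gen: "no_hyperplane_mass (act g \<mu>)" by (rule no_hyperplane_mass_act[OF \<mu> g])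
    show "axis None 1 v* g' \<noteq> 0" by (rule GL_row_mult_nonzero[OF g'(1)]) simp
    fix s :: "complex ^ 'p option" assume "s \<noteq> 0"
    then have "s v* g \<noteq> 0" by (rule GL_row_mult_nonzero[OF g])
    then obtain h k where h: "h \<in> unimodular_stabilizer \<mu>" "k \<noteq> 0" "h $ None = k *s (s v* g)"
      by (rule stabilizer_transitive[OF \<mu> closed])
    have hG: "h \<in> GL" "act h \<mu> = \<mu>" using h(1) by (auto simp: unimodular_stabilizer_def)
    define u where "u = g ** h ** g'"
    have ug: "u ** g = g ** h" by (simp add: u_def matrix_mul_assoc[symmetric] g'(3))
    have u: "unitary u" by (rule unitary[OF h(1) ug])
    have "act u (act g \<mu>) = act (g ** h) \<mu>" unfolding ug[symmetric] by (rule act_mult[OF \<mu>(1) null[OF g]])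
    also have "\<dots> = act g \<mu>" using act_mult[OF \<mu>(1) null[OF hG(1)], of g] hG(2) by simp
    finally have "act u (act g \<mu>) = act g \<mu>" .
    moreover have "(axis None 1 v* g') v* u = k *s s"
    proof -
      have "g' ** u = h ** g'" by (simp add: u_def matrix_mul_assoc g'(3))
      then have "(axis None 1 v* g') v* u = (h $ None) v* g'"
        by (simp add: vector_matrix_mul_assoc axis_vector_matrix_mult[symmetric])
      also have "\<dots> = k *s s"
        by (simp add: h(3) scalar_vector_matrix_assoc vector_matrix_mul_assoc g'(2))
      finally show ?thesis .
    qed
    ultimately show "\<exists>u k. unitary u \<and> act u (act g \<mu>) = act g \<mu> \<and> k \<noteq> 0 \<and> axis None 1 v* g' v* u = k *s s"
      using u h(2) by blast
  qed
  then have "\<mu> = act g' std_cauchy"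
    using act_inverse[OF \<mu>(1) null[OF g] g'(3)] by simp
  then show ?thesis
    using act_GL_std_cauchy[OF g'(1)] by (metis is_cauchy_def)
qed

lemma cauchy_imp_closed:
  fixes \<mu> :: "(complex ^ 'p::finite) measure"
  assumes \<mu>: "is_cauchy \<mu>" and g: "g \<in> GL"
  shows "\<exists>a\<in>Aff. act g \<mu> = act a \<mu>"
proof -
  obtain \<alpha> where \<alpha>: "\<alpha> \<in> Aff" "\<mu> = act \<alpha> std_cauchy" using \<mu> by (auto simp: is_cauchy_def)
  obtain b where b: "b \<in> Aff" "b ** \<alpha> = mat 1" using Aff_inverse[OF \<alpha>(1)] by metis
  have null: "emeasure \<nu> {z. denom c z = 0} = 0" if c: "c \<in> Aff" for c and \<nu> :: "(complex ^ 'p) measure"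
  proof -
    obtain k where "k \<noteq> 0" "\<And>z. denom c z = k" using AffE[OF c] by metis
    then show ?thesis by simp
  qed
  have cauchy: "act b \<mu> = std_cauchy" unfolding \<alpha>(2) by (rule act_inverse[OF _ null[OF \<alpha>(1)] b(2)]) simp
  obtain a where a: "a \<in> Aff" "act (g ** \<alpha>) std_cauchy = act a std_cauchy"
    using act_GL_std_cauchy[OF GL_mult[OF g Aff_GL[OF \<alpha>(1)]]] .
  have "act g \<mu> = act (g ** \<alpha>) std_cauchy"
    unfolding \<alpha>(2) by (rule act_mult[OF _ null[OF \<alpha>(1)]]) simp
  also have "\<dots> = act a (act b \<mu>)" by (simp add: a(2) cauchy)
  also have "\<dots> = act (a ** b) \<mu>" by (rule act_mult[OF _ null[OF b(1)]]) (simp add: \<alpha>(2))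
  finally show ?thesis using Aff_mult[OF a(1) b(1)] by blast
qed

theorem theorem1:
  fixes \<mu> :: "(complex ^ 'p::finite) measure"
  assumes "prob_space \<mu>" and "sets \<mu> = sets borel"
    and "\<And>(c :: complex ^ 'p) (d :: complex). (c, d) \<noteq> (0, 0) \<Longrightarrow>
           emeasure \<mu> {z. scalar_product c z + d = 0} = 0"
  shows "is_cauchy \<mu> \<longleftrightarrow>
    (\<forall>g \<in> (GL :: (complex ^ 'p option ^ 'p option) set). \<exists>a \<in> Aff. act g \<mu> = act a \<mu>)"
proof -
  have "no_hyperplane_mass \<mu>"
    unfolding no_hyperplane_mass_def
  proof (intro allI impI)
    fix s :: "complex ^ 'p option" assume s: "s \<noteq> 0"
    let ?c = "\<chi> j. s $ Some j"
    have "(?c, s $ None) \<noteq> (0, 0)"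
    proof
      assume 0: "(?c, s $ None) = (0, 0)"
      have "s $ i = 0" for i using 0 by (cases i) (auto simp: vec_eq_iff)
      then show False using s by (simp add: vec_eq_iff)
    qed
    moreover have "scalar_product s (homog z) = scalar_product ?c z + s $ None" for z
      by (simp add: scalar_product_def sum_UNIV_option)
    ultimately show "emeasure \<mu> {z. scalar_product s (homog z) = 0} = 0"
      using assms(3)[of ?c "s $ None"] by simp
  qed
  then show ?thesis
    using closed_imp_cauchy[OF assms(1,2)] cauchy_imp_closed by blast
qed

end
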